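(* Let $m\ge 1$ be an integer, $1<p_1,\dots,p_m<\infty$, $0\le\alpha<mn$, $\frac1p=\frac1{p_1}+\cdots+\frac1{p_m}$ and $p\le q<\infty$. Let $\omega_1,\dots,\omega_m$ and $v$ be weights on $\mathbb R^n$, put $\sigma_i=\omega_i^{1-p_i'}$ ($i=1,\dots,m$) and $\nu_{\vec\omega}=\prod_{i=1}^m\sigma_i^{p/p_i}$. Suppose that there is a constant $K>0$ such that for every cube $Q$, $$\prod_{i=1}^m\left(\int_Q\sigma_i(x)\,dx\right)^{p/p_i}\le K\int_Q\prod_{i=1}^m\sigma_i(x)^{p/p_i}\,dx=K\,\nu_{\vec\omega}(Q).$$ Define $$[\nu_{\vec\omega},v]_{S_{\vec P,q}}=\sup_{Q}\frac{\left(\int_Q\left(\mathcal M_\alpha(\sigma_1\chi_Q,\dots,\sigma_m\chi_Q)(x)\right)^q v(x)\,dx\right)^{1/q}}{\left(\nu_{\vec\omega}(Q)\right)^{1/p}},$$ the supremum being over all cubes $Q\subset\mathbb R^n$. Then $\mathcal M_\alpha$ is bounded from $L^{p_1}(\omega_1)\times\cdots\times L^{p_m}(\omega_m)$ to $L^q(v)$ if and only if $[\nu_{\vec\omega},v]_{S_{\vec P,q}}$ is finite. Moreover, $$C^{-1}[\nu_{\vec\omega},v]_{S_{\vec P,q}}\le\|\mathcal M_\alpha\|_{\left(\prod_{i=1}^m L^{p_i}(\omega_i)\right)\to L^q(v)}\le C\,[\nu_{\vec\omega},v]_{S_{\vec P,q}},$$ where $C>0$ depends only on $n,m,\alpha,p_1,\dots,p_m,q$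 and $K$.
   Context: Cubes in $\mathbb R^n$ are non-degenerate with sides parallel to the axes; $|Q|$ is Lebesgue measure. A weight is a locally integrable function on $\mathbb R^n$ that is positive almost everywhere; the functions $\sigma_i$ are also assumed to be weights. For a weight $\omega$, $\omega(Q)=\int_Q\omega(x)\,dx$, and $L^p(\omega)$ is the space of measurable $f$ with $\int_{\mathbb R^n}|f|^p\omega\,dx<\infty$. $p_i'$ is the conjugate exponent of $p_i$. The multilinear fractional maximal function is, for $\vec f=(f_1,\dots,f_m)$ measurable, $$\mathcal M_\alpha\vec f(x)=\sup_Q|Q|^{\alpha/n}\prod_{i=1}^m\frac{\chi_Q(x)}{|Q|}\int_Q|f_i(y)|\,dy ,$$ the supremum over all cubes $Q$. $\|\mathcal M_\alpha\|_{(\prod L^{p_i}(\omega_i))\to L^q(v)}$ is the least constant $K'$ (possibly $\infty$) with $\|\mathcal M_\alpha\vec f\|_{L^q(v)}\le K'\prod_{i=1}^m\|f_i\|_{L^{p_i}(\omega_i)}$ for all $\vec f$. *)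

theory Defs
  imports "HOL-Analysis.Analysis"
begin

text \<open>Closed cubes are used; passing to open or half-open cubes does not change the maximal
  function below.\<close>

definition cubes :: "(real ^ 'n) set set" where
  "cubes = {cbox a (a + (\<chi> i. l)) | a l. l > 0}"

text \<open>Real powers of extended nonnegative numbers; only positive exponents are used.\<close>

definition ennreal_powr :: "ennreal \<Rightarrow> real \<Rightarrow> ennreal" (infixr \<open>epowr\<close> 80) where
  "x epowr a = (if x = \<infinity> then \<infinity> else ennreal (enn2real x powr a))"

definition is_weight :: "(real ^ 'n \<Rightarrow> real) \<Rightarrow> bool" where
  "is_weight w \<longleftrightarrow>
     w \<in> borel_measurable lebesgue \<and>
     (\<forall>A. compact A \<longrightarrow> set_integrable lebesgue A w) \<and>
     (AE x in lebesgue. w x > 0)"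

definition weight_of :: "(real ^ 'n \<Rightarrow> real) \<Rightarrow> (real ^ 'n) set \<Rightarrow> ennreal" where
  "weight_of w Q = (\<integral>\<^sup>+x\<in>Q. ennreal (w x) \<partial>lebesgue)"

definition conj_exponent :: "real \<Rightarrow> real" where
  "conj_exponent p = p / (p - 1)"

definition dual_weight :: "real \<Rightarrow> (real ^ 'n \<Rightarrow> real) \<Rightarrow> real ^ 'n \<Rightarrow> real" where
  "dual_weight p w x = w x powr (1 - conj_exponent p)"

definition nu_weight ::
  "nat \<Rightarrow> (nat \<Rightarrow> real) \<Rightarrow> real \<Rightarrow> (nat \<Rightarrow> real ^ 'n \<Rightarrow> real) \<Rightarrow> real ^ 'n \<Rightarrow> real" where
  "nu_weight m P p w x = (\<Prod>i=1..m. dual_weight (P i) (w i) x powr (p / P i))"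

text \<open>The weighted norm is taken of an extended nonnegative function, so that it applies both to
  absolute values and to the maximal function, which may take the value infinity.\<close>

definition weighted_norm :: "real \<Rightarrow> (real ^ 'n \<Rightarrow> real) \<Rightarrow> (real ^ 'n \<Rightarrow> ennreal) \<Rightarrow> ennreal" where
  "weighted_norm p w g = (\<integral>\<^sup>+x. (g x epowr p) * ennreal (w x) \<partial>lebesgue) epowr (1 / p)"

definition weighted_Lp :: "real \<Rightarrow> (real ^ 'n \<Rightarrow> real) \<Rightarrow> (real ^ 'n \<Rightarrow> real) set" where
  "weighted_Lp p w =
     {f \<in> borel_measurable lebesgue. (\<integral>\<^sup>+x. ennreal (\<bar>f x\<bar> powr p) * ennreal (w x) \<partial>lebesgue) < \<infinity>}"

definition maximal ::
  "nat \<Rightarrow> real \<Rightarrow> (nat \<Rightarrow> real ^ 'n \<Rightarrow> real) \<Rightarrow> real ^ 'n \<Rightarrow> ennreal" where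
  "maximal m \<alpha> f x =
     (SUP Q\<in>cubes. ennreal (measure lebesgue Q powr (\<alpha> / real CARD('n))) *
        (\<Prod>i=1..m. ennreal (indicator Q x / measure lebesgue Q) *
                    (\<integral>\<^sup>+y\<in>Q. ennreal \<bar>f i y\<bar> \<partial>lebesgue)))"

definition maximal_bound ::
  "nat \<Rightarrow> real \<Rightarrow> (nat \<Rightarrow> real) \<Rightarrow> (nat \<Rightarrow> real ^ 'n \<Rightarrow> real) \<Rightarrow> real \<Rightarrow> (real ^ 'n \<Rightarrow> real) \<Rightarrow>
   ennreal \<Rightarrow> bool" where
  "maximal_bound m \<alpha> P w q v B \<longleftrightarrow>
     (\<forall>f. (\<forall>i\<in>{1..m}. f i \<in> weighted_Lp (P i) (w i)) \<longrightarrow>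
        weighted_norm q v (maximal m \<alpha> f) \<le>
          B * (\<Prod>i=1..m. weighted_norm (P i) (w i) (\<lambda>x. ennreal \<bar>f i x\<bar>)))"

definition maximal_bounded ::
  "nat \<Rightarrow> real \<Rightarrow> (nat \<Rightarrow> real) \<Rightarrow> (nat \<Rightarrow> real ^ 'n \<Rightarrow> real) \<Rightarrow> real \<Rightarrow> (real ^ 'n \<Rightarrow> real) \<Rightarrow> bool" where
  "maximal_bounded m \<alpha> P w q v \<longleftrightarrow> (\<exists>B<\<infinity>. maximal_bound m \<alpha> P w q v B)"

text \<open>The infimum is infinite when there is no finite bound, and is itself a bound otherwise
  because every norm on the right-hand side of the bound is finite.\<close>

definition maximal_norm ::
  "nat \<Rightarrow> real \<Rightarrow> (nat \<Rightarrow> real) \<Rightarrow> (nat \<Rightarrow> real ^ 'n \<Rightarrow> real) \<Rightarrow> real \<Rightarrow> (real ^ 'n \<Rightarrow> real) \<Rightarrow> ennreal" where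
  "maximal_norm m \<alpha> P w q v = Inf {B. maximal_bound m \<alpha> P w q v B}"

definition sawyer_const ::
  "nat \<Rightarrow> real \<Rightarrow> (nat \<Rightarrow> real) \<Rightarrow> real \<Rightarrow> (nat \<Rightarrow> real ^ 'n \<Rightarrow> real) \<Rightarrow> real \<Rightarrow> (real ^ 'n \<Rightarrow> real) \<Rightarrow>
   ennreal" where
  "sawyer_const m \<alpha> P p w q v =
     (SUP Q\<in>cubes.
        ((\<integral>\<^sup>+x\<in>Q. (maximal m \<alpha> (\<lambda>i y. dual_weight (P i) (w i) y * indicator Q y) x epowr q)
                    * ennreal (v x) \<partial>lebesgue) epowr (1 / q))
        / (weight_of (nu_weight m P p w) Q epowr (1 / p)))"

end

theory Submission
  imports Defs
begin

text \<open>
  Necessity is tested on \<open>f\<^sub>i = \<sigma>\<^sub>i \<chi>\<^sub>Q\<close>: then \<open>\<parallel>f\<^sub>i\<parallel>\<close> is the power \<open>1 / p\<^sub>i\<close> of \<open>\<sigma>\<^sub>i(Q)\<close>, and the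
  reverse Hoelder condition with constant \<open>K\<close> bounds the product of these by a power of \<open>\<nu>(Q)\<close>.

  For sufficiency, every cube lies in a comparable cube of one of \<open>2\<^sup>n\<close> dyadic grids (the one-third
  trick), so it suffices to treat a finite nested family \<open>F\<close>. Linearise the maximal function over \<open>F\<close>
  by disjoint sets \<open>E(Q) \<subseteq> Q\<close> on which \<open>Q\<close> realises the supremum; this gives a sum over \<open>Q \<in> F\<close> of
  \<open>\<mu>(Q)\<close> times the \<open>q\<close>-th power of a product of \<open>\<sigma>\<^sub>i\<close>-averages of \<open>f\<^sub>i / \<sigma>\<^sub>i\<close>. The testing condition says
  exactly that \<open>\<mu>\<close> is a Carleson sequence relative to the power \<open>q / p\<close> of \<open>\<nu>\<close>. Splitting the sum into
  dyadic level sets of the product of averages, using \<open>q \<ge> p\<close>, and combining Hoelder's inequality with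
  the maximal inequality for each measure \<open>\<sigma>\<^sub>i\<close> yields the embedding. Fatou's lemma exhausts the grids.
\<close>

section \<open>Elementary inequalities\<close>

text \<open>Sufficiency turns on a factorisation. With g_i = |f_i| / \<sigma>_i, the fractional
  average of f over Q is the fractional average b(Q) of the dual weights times the product of the
  averages of the g_i for the measures \<sigma>_i dx. The first factor sees only weights, and b(Q)^q
  v(E(Q)) is the \<mu>(Q) of the overview. The second calls for maximal functions of measures that
  may fail to be doubling; on nested families these are bounded with a constant depending only on
  the exponent.

  The assumption p \<le> q enters through superadditivity of the power q/p, used twice: inside one
  level, to add up \<nu> over the maximal cubes, and across levels, to pull the power out of the
  sum. What remains is an integral of the p-th power of a product of maximal functions against
  \<nu>, and since the exponents p/p_i sum to 1, Hoelder separates it into one maximal inequality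
  for each i.

  Before the final limit all families are finite, so suprema are maxima and sums are finite. The
  reverse Hoelder constant enters C through necessity, as \<open>K powr (1 / p)\<close>.\<close>

lemma sum_dyadic_powr_le:
  fixes s :: real and a b :: int
  assumes "s > 0" "a \<le> b"
  shows "(\<Sum>k\<in>{a..b}. (2 powr real_of_int k) powr s) \<le> (2 powr real_of_int b) powr s / (1 - 2 powr (-s))"
  using assms(2)
proof (induction b rule: int_ge_induct)
  case base
  have "2 powr (-s) < 1" using assms by (simp add: powr_less_one)
  moreover have "2 powr (-s) > (0::real)" by simp
  ultimately show ?case by (simp add: field_simps)
next
  case (step b)
  define c where "c = 1 - 2 powr (-s)"
  have c: "c > 0" using assms(1) by (simp add: powr_less_one c_def)
  have "{a..b+1} = insert (b+1) {a..b}" using step by auto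
  then have "(\<Sum>k\<in>{a..b+1}. (2 powr real_of_int k) powr s)
      = (2 powr real_of_int (b+1)) powr s + (\<Sum>k\<in>{a..b}. (2 powr real_of_int k) powr s)" by simp
  also have "\<dots> \<le> (2 powr real_of_int (b+1)) powr s + (2 powr real_of_int b) powr s / c"
    using step by (simp add: c_def)
  also have "(2 powr real_of_int b) powr s = (2 powr real_of_int (b+1)) powr s * (1 - c)"
    by (simp add: c_def powr_powr powr_add[symmetric] algebra_simps)
  finally show ?case unfolding c_def[symmetric] using c by (simp add: field_simps)
qed

text \<open>A geometric series is controlled by its largest term, and that term stays below
  \<open>x powr s\<close>; so the bound does not see how many indices \<open>I\<close>
  contains.\<close>

lemma sum_dyadic_below_le:
  fixes s x :: real and I :: "int set"
  assumes "s > 0" "x \<ge> 0" "finite I"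
  shows "(\<Sum>k\<in>{k\<in>I. 2 powr real_of_int k < x}. (2 powr real_of_int k) powr s)
           \<le> x powr s / (1 - 2 powr (-s))"
proof (cases "{k\<in>I. 2 powr real_of_int k < x} = {}")
  case True
  have "2 powr (-s) < 1" using assms by (simp add: powr_less_one)
  then show ?thesis unfolding True by simp
next
  case False
  define J where "J = {k\<in>I. 2 powr real_of_int k < x}"
  have J: "finite J" "J \<noteq> {}" using assms False by (auto simp: J_def)
  have c: "1 - 2 powr (-s) > 0" using assms(1) by (simp add: powr_less_one)
  have "Max J \<in> J" using J by simp
  then have m: "2 powr real_of_int (Max J) < x" by (simp add: J_def)
  have "(\<Sum>k\<in>J. (2 powr real_of_int k) powr s) \<le> (\<Sum>k\<in>{Min J..Max J}. (2 powr real_of_int k) powr s)"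
    using J by (intro sum_mono2) auto
  also have "\<dots> \<le> (2 powr real_of_int (Max J)) powr s / (1 - 2 powr (-s))"
    using J assms by (intro sum_dyadic_powr_le) auto
  also have "\<dots> \<le> x powr s / (1 - 2 powr (-s))"
    using c m assms by (intro divide_right_mono powr_mono2) auto
  finally show ?thesis unfolding J_def .
qed

text \<open>Finitely many values occupy finitely many dyadic levels, which keeps the later
  decompositions into levels finite sums.\<close>

lemma dyadic_level_exists:
  fixes A :: "real set"
  assumes "finite A"
  obtains I :: "int set" where "finite I"
    "\<And>x. x \<in> A \<Longrightarrow> x > 0 \<Longrightarrow> \<exists>k\<in>I. 2 powr real_of_int k < x \<and> x \<le> 2 * 2 powr real_of_int k"
proof -
  \<comment> \<open>Ceiling minus one rather than floor: the lower inequality becomes strict,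
    matching the strict inequality that defines the level families.\<close>
  define h where "h x = \<lceil>log 2 x\<rceil> - 1" for x :: real
  have "2 powr real_of_int (h x) < x \<and> x \<le> 2 * 2 powr real_of_int (h x)" if "x > 0" for x
  proof
    have "real_of_int (h x) < log 2 x" unfolding h_def by linarith
    then show "2 powr real_of_int (h x) < x" using that by (simp add: less_log_iff)
    have "log 2 x \<le> real_of_int (h x) + 1" unfolding h_def by linarith
    then have "x \<le> 2 powr (real_of_int (h x) + 1)" using that by (simp add: log_le_iff)
    then show "x \<le> 2 * 2 powr real_of_int (h x)" by (simp add: powr_add)
  qed
  then show thesis using assms by (intro that[of "h ` A"]) auto
qed

text \<open>Split off one factor of \<open>x a powr t\<close> and enlarge the remaining
  \<open>x a powr (t - 1)\<close> to the power of the total. With \<open>t = q / p\<close> this is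
  how \<open>p \<le> q\<close> is exploited.\<close>

lemma sum_powr_le_powr_sum:
  fixes x :: "'a \<Rightarrow> real"
  assumes "finite A" "\<And>a. a \<in> A \<Longrightarrow> x a \<ge> 0" "t \<ge> 1"
  shows "(\<Sum>a\<in>A. x a powr t) \<le> (\<Sum>a\<in>A. x a) powr t"
proof -
  define S where "S = (\<Sum>a\<in>A. x a)"
  have S: "S \<ge> 0" unfolding S_def by (simp add: assms sum_nonneg)
  have *: "y powr t = y * y powr (t-1)" if "y \<ge> 0" for y :: real
    using that by (cases "y = 0") (auto simp: powr_diff)
  have "(\<Sum>a\<in>A. x a powr t) \<le> (\<Sum>a\<in>A. x a * S powr (t-1))"
  proof (rule sum_mono)
    fix a assume a: "a \<in> A"
    have "x a \<le> S" unfolding S_def using a assms by (intro member_le_sum) auto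
    then show "x a powr t \<le> x a * S powr (t-1)"
      using a assms by (subst *) (auto intro!: mult_left_mono powr_mono2)
  qed
  also have "\<dots> = S powr t" using S by (simp add: * sum_distrib_right[symmetric] S_def[symmetric])
  finally show ?thesis unfolding S_def .
qed

section \<open>Weighted AM-GM and Hoelder's inequality for several functions\<close>

lemma prod_powr_eq_0:
  fixes x :: "'a \<Rightarrow> real"
  assumes "finite I" "i \<in> I" "x i = 0"
  shows "(\<Prod>i\<in>I. x i powr \<theta> i) = 0"
  using assms by (auto simp: prod_zero_iff)

text \<open>Jensen's inequality for exp at the points \<open>ln (x i)\<close>. A vanishing
  \<open>x i\<close> makes the left side 0 and is split off, because its logarithm is of no
  use.\<close>

lemma weighted_am_gm:
  fixes x \<theta> :: "'a \<Rightarrow> real"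
  assumes "finite I" "I \<noteq> {}" "\<And>i. i \<in> I \<Longrightarrow> x i \<ge> 0" "\<And>i. i \<in> I \<Longrightarrow> \<theta> i > 0" "(\<Sum>i\<in>I. \<theta> i) = 1"
  shows "(\<Prod>i\<in>I. x i powr \<theta> i) \<le> (\<Sum>i\<in>I. \<theta> i * x i)"
proof (cases "\<exists>i\<in>I. x i = 0")
  case True
  then have "(\<Prod>i\<in>I. x i powr \<theta> i) = 0" using prod_powr_eq_0[OF assms(1)] by blast
  moreover have "(\<Sum>i\<in>I. \<theta> i * x i) \<ge> 0"
    by (intro sum_nonneg mult_nonneg_nonneg) (simp_all add: assms less_imp_le)
  ultimately show ?thesis by simp
next
  case False
  then have pos: "x i > 0" if "i \<in> I" for i using assms(3) that by (metis less_eq_real_def)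
  have "(\<Prod>i\<in>I. x i powr \<theta> i) = (\<Prod>i\<in>I. exp (\<theta> i * ln (x i)))"
    using pos by (intro prod.cong) (auto simp: powr_def, metis less_irrefl)
  also have "\<dots> = exp (\<Sum>i\<in>I. \<theta> i * ln (x i))" using assms by (simp add: exp_sum)
  also have "\<dots> \<le> (\<Sum>i\<in>I. \<theta> i * exp (ln (x i)))"
    using convex_on_sum[OF assms(1,2) exp_convex assms(5), of "\<lambda>i. ln (x i)"] assms by (auto simp: less_imp_le)
  also have "\<dots> = (\<Sum>i\<in>I. \<theta> i * x i)" using pos by simp
  finally show ?thesis .
qed

text \<open>Hoelder's inequality by normalisation: for \<open>h i / c i\<close>, AM-GM bounds the
  product pointwise by a sum whose integral is at most the sum of the \<open>\<theta> i\<close>,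
  which is 1.\<close>

lemma nn_integral_prod_powr_le:
  fixes h :: "'a \<Rightarrow> 'b \<Rightarrow> real"
  assumes I: "finite I" "I \<noteq> {}" "\<And>i. i \<in> I \<Longrightarrow> \<theta> i > 0" "(\<Sum>i\<in>I. \<theta> i) = 1"
    and h: "\<And>i. i \<in> I \<Longrightarrow> h i \<in> borel_measurable M" "\<And>i x. i \<in> I \<Longrightarrow> h i x \<ge> 0"
    and c: "\<And>i. i \<in> I \<Longrightarrow> c i \<ge> 0" "\<And>i. i \<in> I \<Longrightarrow> (\<integral>\<^sup>+x. h i x \<partial>M) \<le> ennreal (c i)"
  shows "(\<integral>\<^sup>+x. (\<Prod>i\<in>I. h i x powr \<theta> i) \<partial>M) \<le> ennreal (\<Prod>i\<in>I. c i powr \<theta> i)"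
proof (cases "\<exists>i\<in>I. c i = 0")
  \<comment> \<open>Dividing by \<open>c i = 0\<close> is impossible, but then \<open>h i\<close>
    vanishes almost everywhere and the product with it.\<close>
  case True
  then obtain i where i: "i \<in> I" "c i = 0" by auto
  then have "(\<integral>\<^sup>+x. h i x \<partial>M) = 0" using c(2)[of i] by simp
  then have "AE x in M. h i x = 0"
    using h[of i] i by (subst (asm) nn_integral_0_iff_AE) (auto simp: ennreal_eq_0_iff intro: antisym)
  then have "(\<integral>\<^sup>+x. (\<Prod>i\<in>I. h i x powr \<theta> i) \<partial>M) = (\<integral>\<^sup>+x. 0 \<partial>M)"
    using I i by (intro nn_integral_cong_AE) (auto elim!: eventually_mono simp: prod_powr_eq_0)
  then show ?thesis by simp
next
  case False
  then have pos: "c i > 0" if "i \<in> I" for i using c(1) that by (metis less_eq_real_def)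
  define D where "D = (\<Prod>i\<in>I. c i powr \<theta> i)"
  have D: "D > 0" unfolding D_def using pos by (intro prod_pos) (simp, metis less_irrefl)
  have *: "(\<Prod>i\<in>I. h i x powr \<theta> i) \<le> (\<Sum>i\<in>I. D * \<theta> i / c i * h i x)" for x
  proof -
    have "(\<Prod>i\<in>I. h i x powr \<theta> i) = D * (\<Prod>i\<in>I. (h i x / c i) powr \<theta> i)"
      unfolding D_def prod.distrib[symmetric] using pos
      by (intro prod.cong) (auto simp: powr_divide h less_imp_le, metis less_irrefl)
    also have "\<dots> \<le> D * (\<Sum>i\<in>I. \<theta> i * (h i x / c i))"
      using D I pos h by (intro mult_left_mono weighted_am_gm) (auto simp: less_imp_le)
    finally show ?thesis by (simp add: sum_distrib_left mult.assoc)
  qed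
  have "(\<integral>\<^sup>+x. (\<Prod>i\<in>I. h i x powr \<theta> i) \<partial>M) \<le> (\<integral>\<^sup>+x. (\<Sum>i\<in>I. ennreal (D * \<theta> i / c i) * ennreal (h i x)) \<partial>M)"
  proof (intro nn_integral_mono)
    fix x
    have "(\<Sum>i\<in>I. ennreal (D * \<theta> i / c i) * ennreal (h i x)) = ennreal (\<Sum>i\<in>I. D * \<theta> i / c i * h i x)"
      using D I(3) pos h(2) by (subst sum_ennreal[symmetric])
        (auto simp: ennreal_mult' less_imp_le simp del: times_divide_eq_left intro!: sum.cong)
    then show "ennreal (\<Prod>i\<in>I. h i x powr \<theta> i) \<le> (\<Sum>i\<in>I. ennreal (D * \<theta> i / c i) * ennreal (h i x))"
      using *[of x] by (simp add: ennreal_leI)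
  qed
  also have "\<dots> = (\<Sum>i\<in>I. ennreal (D * \<theta> i / c i) * (\<integral>\<^sup>+x. ennreal (h i x) \<partial>M))"
    using h by (simp add: nn_integral_sum nn_integral_cmult)
  also have "\<dots> \<le> (\<Sum>i\<in>I. ennreal (D * \<theta> i / c i) * ennreal (c i))"
    using c by (intro sum_mono mult_left_mono) auto
  also have "\<dots> = (\<Sum>i\<in>I. ennreal (D * \<theta> i))"
    using D I pos by (intro sum.cong) (auto simp: ennreal_mult[symmetric] less_imp_le, metis less_irrefl)
  also have "\<dots> = ennreal (\<Sum>i\<in>I. D * \<theta> i)"
    using D I by (intro sum_ennreal) (auto simp: less_imp_le)
  also have "(\<Sum>i\<in>I. D * \<theta> i) = D" using I by (simp add: sum_distrib_left[symmetric])
  finally show ?thesis unfolding D_def .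
qed

section \<open>Nested families, maximal members and disjoint selections\<close>

definition nested :: "'a set set \<Rightarrow> bool" where
  "nested F \<longleftrightarrow> (\<forall>Q\<in>F. \<forall>R\<in>F. Q \<inter> R = {} \<or> Q \<subseteq> R \<or> R \<subseteq> Q)"

lemma nested_subset: "nested F \<Longrightarrow> G \<subseteq> F \<Longrightarrow> nested G"
  unfolding nested_def by blast

text \<open>\<open>H\<close> consists of the members maximal under inclusion. Two different ones are
  never comparable, so nestedness makes them disjoint; finiteness puts every member below a maximal
  one.\<close>

lemma nested_maximal_cover:
  assumes "finite G" "nested G"
  shows "\<exists>H\<subseteq>G. disjoint H \<and> \<Union>H = \<Union>G \<and> (\<forall>Q\<in>G. \<exists>R\<in>H. Q \<subseteq> R)"
proof -
  define H where "H = {R\<in>G. \<forall>Q\<in>G. R \<subseteq> Q \<longrightarrow> R = Q}"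
  have "H \<subseteq> G" by (auto simp: H_def)
  moreover have ex: "\<forall>Q\<in>G. \<exists>R\<in>H. Q \<subseteq> R"
  proof
    fix Q assume "Q \<in> G"
    from finite_has_maximal2[OF assms(1) this] obtain R where
      "R \<in> G" "Q \<subseteq> R" "\<forall>S\<in>G. R \<subseteq> S \<longrightarrow> R = S" by (elim bexE conjE)
    then show "\<exists>R\<in>H. Q \<subseteq> R" unfolding H_def by (intro bexI[of _ R]) simp_all
  qed
  moreover have "disjoint H"
  proof (rule disjointI)
    fix Q R assume "Q \<in> H" "R \<in> H" "Q \<noteq> R"
    then have "Q \<in> G" "R \<in> G" "\<not> Q \<subseteq> R" "\<not> R \<subseteq> Q" by (auto simp: H_def)
    then show "Q \<inter> R = {}" using assms(2) unfolding nested_def by blast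
  qed
  moreover have "\<Union>H = \<Union>G" using ex \<open>H \<subseteq> G\<close> by blast
  ultimately show ?thesis by (intro exI[of _ H]) simp
qed

text \<open>Induct in order of increasing \<open>a\<close>. The newly inserted set has the largest
  value so far, so it keeps all its points and the earlier sets give them up; each point ends in a
  set of largest \<open>a\<close> among those containing it.\<close>

lemma disjoint_linearization:
  fixes a :: "'a set \<Rightarrow> real"
  assumes "finite F" "F \<subseteq> sets M"
  obtains E where "\<And>Q. Q \<in> F \<Longrightarrow> E Q \<in> sets M" "\<And>Q. Q \<in> F \<Longrightarrow> E Q \<subseteq> Q" "disjoint_family_on E F"
    "\<And>x Q. Q \<in> F \<Longrightarrow> x \<in> Q \<Longrightarrow> \<exists>R\<in>F. x \<in> E R \<and> a Q \<le> a R"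
proof -
  have "\<exists>E. (\<forall>Q\<in>F. E Q \<in> sets M \<and> E Q \<subseteq> Q) \<and> disjoint_family_on E F \<and>
      (\<forall>Q\<in>F. \<forall>x\<in>Q. \<exists>R\<in>F. x \<in> E R \<and> a Q \<le> a R)"
    using assms
  proof (induction F rule: finite_ranking_induct[where f=a])
    case empty
    then show ?case by (auto simp: disjoint_family_on_def)
  next
    case (insert Q F)
    then obtain E where E: "\<forall>Q\<in>F. E Q \<in> sets M \<and> E Q \<subseteq> Q" "disjoint_family_on E F"
      "\<forall>Q\<in>F. \<forall>x\<in>Q. \<exists>R\<in>F. x \<in> E R \<and> a Q \<le> a R" by auto
    define E' where "E' R = (if R = Q then Q else E R - Q)" for R
    have "\<exists>R\<in>insert Q F. x \<in> E' R \<and> a S \<le> a R" if S: "S \<in> insert Q F" "x \<in> S" for x S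
    proof (cases "x \<in> Q")
      case True
      then have "x \<in> E' Q" by (simp add: E'_def)
      moreover have "a S \<le> a Q" using insert.hyps that by auto
      ultimately show ?thesis by blast
    next
      case False
      then have "S \<in> F" using that by auto
      then obtain R where "R \<in> F" "x \<in> E R" "a S \<le> a R" using E(3) S(2) by fast
      then have "x \<in> E' R" using False E(1) by (auto simp: E'_def)
      then show ?thesis using \<open>R \<in> F\<close> \<open>a S \<le> a R\<close> by blast
    qed
    then have "\<forall>S\<in>insert Q F. \<forall>x\<in>S. \<exists>R\<in>insert Q F. x \<in> E' R \<and> a S \<le> a R" by simp
    moreover have "disjoint_family_on E' (insert Q F)"
      unfolding disjoint_family_on_def
    proof (intro ballI impI)
      fix A B assume AB: "A \<in> insert Q F" "B \<in> insert Q F" "A \<noteq> B"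
      have "E A \<inter> E B = {}" if "A \<noteq> Q" "B \<noteq> Q"
        using E(2) AB that by (auto simp: disjoint_family_on_def)
      then show "E' A \<inter> E' B = {}" using AB(3) by (auto simp: E'_def)
    qed
    moreover have "\<forall>R\<in>insert Q F. E' R \<in> sets M \<and> E' R \<subseteq> R"
      using E(1) insert.prems unfolding E'_def by auto
    ultimately show ?case by (intro exI[of _ E']) simp
  qed
  then obtain E where E: "\<forall>Q\<in>F. E Q \<in> sets M \<and> E Q \<subseteq> Q" "disjoint_family_on E F"
      "\<forall>Q\<in>F. \<forall>x\<in>Q. \<exists>R\<in>F. x \<in> E R \<and> a Q \<le> a R" by (elim exE conjE)
  show thesis
  proof (rule that)
    show "disjoint_family_on E F" by (rule E)
    show "E Q \<in> sets M" "E Q \<subseteq> Q" if "Q \<in> F" for Q using E(1) that by auto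
    show "\<exists>R\<in>F. x \<in> E R \<and> a Q \<le> a R" if "Q \<in> F" "x \<in> Q" for x Q using E(3) that by simp
  qed
qed

section \<open>The maximal inequality for nested families\<close>

text \<open>The inserted 0 is the value at points that no member of \<open>F\<close> contains, and
  it keeps \<open>Max\<close> meaningful for empty \<open>F\<close>.\<close>

definition family_max :: "'a set set \<Rightarrow> ('a set \<Rightarrow> real) \<Rightarrow> 'a \<Rightarrow> real" where
  "family_max F A x = Max (insert 0 ((\<lambda>Q. A Q * indicator Q x) ` F))"

lemma family_max_nonneg: "finite F \<Longrightarrow> family_max F A x \<ge> 0"
  unfolding family_max_def by (rule Max_ge) auto

lemma family_max_ge: "finite F \<Longrightarrow> Q \<in> F \<Longrightarrow> x \<in> Q \<Longrightarrow> A Q \<le> family_max F A x"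
  unfolding family_max_def by (rule Max_ge) (auto simp: image_iff intro!: disjI2 bexI[of _ Q])

lemma family_max_attained:
  assumes "finite F" "family_max F A x > 0"
  obtains Q where "Q \<in> F" "x \<in> Q" "A Q = family_max F A x"
proof -
  have "family_max F A x \<in> insert 0 ((\<lambda>Q. A Q * indicator Q x) ` F)"
    unfolding family_max_def using assms(1) by (intro Max_in) auto
  then obtain Q where Q: "Q \<in> F" "family_max F A x = A Q * indicator Q x" using assms(2) by auto
  then have "x \<in> Q" using assms(2) by (cases "x \<in> Q") auto
  then show thesis using Q that by simp
qed

lemma borel_measurable_family_max [measurable]:
  assumes "finite F" "F \<subseteq> sets M"
  shows "family_max F A \<in> borel_measurable M"
proof (cases "F = {}")
  case True
  then show ?thesis by (simp add: family_max_def[abs_def])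
next
  case False
  have "family_max F A = (\<lambda>x. max 0 (Max ((\<lambda>Q. A Q * indicator Q x) ` F)))"
    using False assms by (auto simp: family_max_def fun_eq_iff)
  moreover have "(\<lambda>x. Max ((\<lambda>Q. A Q * indicator Q x) ` F)) \<in> borel_measurable M"
    using assms by (intro borel_measurable_Max borel_measurable_times borel_measurable_const borel_measurable_indicator) auto
  ultimately show ?thesis by simp
qed

lemma sum_set_nn_integral_disjoint:
  assumes "finite H" "H \<subseteq> sets M" "disjoint H" "u \<in> borel_measurable M"
  shows "(\<Sum>Q\<in>H. \<integral>\<^sup>+x\<in>Q. u x \<partial>M) = (\<integral>\<^sup>+x\<in>\<Union>H. u x \<partial>M)"
proof -
  have d: "disjoint_family_on (\<lambda>Q. Q) H" using assms(3) by (auto simp: disjoint_family_on_def disjoint_def)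
  have ind: "indicator (\<Union>H) x = (\<Sum>Q\<in>H. indicator Q x :: ennreal)" for x
    using indicator_UN_disjoint[OF assms(1) d, of x] by simp
  have "(\<Sum>Q\<in>H. \<integral>\<^sup>+x\<in>Q. u x \<partial>M) = (\<integral>\<^sup>+x. (\<Sum>Q\<in>H. u x * indicator Q x) \<partial>M)"
    using assms by (intro nn_integral_sum[symmetric]) auto
  also have "\<dots> = (\<integral>\<^sup>+x\<in>\<Union>H. u x \<partial>M)"
    by (simp add: ind sum_distrib_left[symmetric])
  finally show ?thesis .
qed

text \<open>Restricting the integral to \<open>t < g x\<close> lets the strong-type bound follow by summing levels, with no
  absorption of a possibly infinite term.\<close>

lemma nested_weak_type:
  assumes F: "finite F" "F \<subseteq> sets M" "nested F"
    and g: "g \<in> borel_measurable M" "\<And>x. g x \<ge> (0::real)"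
    and fin: "\<And>Q. Q \<in> F \<Longrightarrow> emeasure M Q < \<infinity>"
    and A: "\<And>Q. Q \<in> F \<Longrightarrow> ennreal (A Q) * emeasure M Q \<le> (\<integral>\<^sup>+x\<in>Q. ennreal (g x) \<partial>M)"
    and t: "t > 0"
  shows "ennreal t * emeasure M (\<Union>{Q\<in>F. 2 * t < A Q}) \<le> (\<integral>\<^sup>+x\<in>{x\<in>space M. t < g x}. ennreal (g x) \<partial>M)"
proof -
  define G where "G = {Q\<in>F. 2 * t < A Q}"
  define u where "u x = ennreal (g x) * indicator {x\<in>space M. t < g x} x" for x
  have u: "u \<in> borel_measurable M" unfolding u_def[abs_def] using g by measurable
  have G: "finite G" "nested G" "G \<subseteq> F" using F by (auto simp: G_def intro: nested_subset)
  obtain H where H: "H \<subseteq> G" "disjoint H" "\<Union>H = \<Union>G" using nested_maximal_cover[OF G(1,2)] by (elim exE conjE)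
  have "finite H" using H(1) G(1) by (rule finite_subset)
  moreover have "H \<subseteq> sets M" using H(1) G(3) F(2) by (meson order_trans)
  ultimately have H': "finite H" "H \<subseteq> sets M" .
  have Q: "ennreal t * emeasure M Q \<le> (\<integral>\<^sup>+x\<in>Q. u x \<partial>M)" if "Q \<in> H" for Q
  proof -
    have Q: "Q \<in> F" "2 * t < A Q" "Q \<in> sets M" using that H G H' by (auto simp: G_def)
    \<comment> \<open>This is why the threshold is \<open>2 * t\<close>: the part of
      \<open>g\<close> up to \<open>t\<close> contributes at most \<open>t\<close> times the measure
      of \<open>Q\<close>, which cancels one of the two copies, the measure being finite.\<close>
    have "ennreal t * emeasure M Q + ennreal t * emeasure M Q = ennreal (2 * t) * emeasure M Q"
      using t by (simp add: distrib_right[symmetric] ennreal_plus[symmetric] del: ennreal_plus)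
    also have "\<dots> \<le> ennreal (A Q) * emeasure M Q" using Q by (intro mult_right_mono ennreal_leI) auto
    also have "\<dots> \<le> (\<integral>\<^sup>+x\<in>Q. ennreal (g x) \<partial>M)" using A Q by simp
    also have "\<dots> \<le> (\<integral>\<^sup>+x. ennreal t * indicator Q x + u x * indicator Q x \<partial>M)"
      by (intro nn_integral_mono) (auto simp: u_def indicator_def intro: ennreal_leI)
    also have "\<dots> = ennreal t * emeasure M Q + (\<integral>\<^sup>+x\<in>Q. u x \<partial>M)"
      using Q(3) u by (subst nn_integral_add) (auto simp: nn_integral_cmult)
    finally show ?thesis
      using fin[OF Q(1)] by (subst (asm) ennreal_add_left_cancel_le) (auto simp: ennreal_mult_eq_top_iff)
  qed
  have d: "disjoint_family_on (\<lambda>Q. Q) H" using H(2) by (auto simp: disjoint_family_on_def disjoint_def)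
  have "ennreal t * emeasure M (\<Union>G) = (\<Sum>Q\<in>H. ennreal t * emeasure M Q)"
    using sum_emeasure[OF _ d H'(1)] H' H by (simp add: sum_distrib_left[symmetric])
  also have "\<dots> \<le> (\<Sum>Q\<in>H. \<integral>\<^sup>+x\<in>Q. u x \<partial>M)" by (intro sum_mono Q)
  also have "\<dots> = (\<integral>\<^sup>+x\<in>\<Union>H. u x \<partial>M)" by (rule sum_set_nn_integral_disjoint[OF H' H(2) u])
  also have "\<dots> \<le> (\<integral>\<^sup>+x. u x \<partial>M)" by (intro nn_integral_mono) (auto simp: indicator_def)
  finally show ?thesis unfolding G_def u_def .
qed

text \<open>\<open>2 powr r\<close> rounds the maximal function up to a dyadic level, 2 comes from
  the weak type bound at half that level, and \<open>2 powr (r - 1)\<close> from levels reaching up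
  to \<open>2 * g x\<close>; together they give \<open>4 powr r\<close>. The denominator sums the
  levels with exponent \<open>r - 1\<close>.\<close>

definition maximal_const :: "real \<Rightarrow> real" where
  "maximal_const r = 4 powr r / (1 - 2 powr (1 - r))"

lemma maximal_const_pos: "r > 1 \<Longrightarrow> maximal_const r > 0"
  by (simp add: maximal_const_def powr_less_one)

text \<open>Apply the weak type bound at every dyadic level and exchange sum and integral: at a
  point \<open>x\<close> only levels below \<open>2 * g x\<close> survive, and their powers with
  exponent \<open>r - 1 > 0\<close> sum geometrically. The measure is left general so that weighted
  measures are covered.\<close>

theorem nested_maximal_inequality:
  assumes F: "finite F" "F \<subseteq> sets M" "nested F"
    and g: "g \<in> borel_measurable M" "\<And>x. g x \<ge> (0::real)"
    and fin: "\<And>Q. Q \<in> F \<Longrightarrow> emeasure M Q < \<infinity>"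
    and A: "\<And>Q. Q \<in> F \<Longrightarrow> ennreal (A Q) * emeasure M Q \<le> (\<integral>\<^sup>+x\<in>Q. ennreal (g x) \<partial>M)"
    and r: "r > 1"
  shows "(\<integral>\<^sup>+x. ennreal (family_max F A x powr r) \<partial>M)
           \<le> ennreal (maximal_const r) * (\<integral>\<^sup>+x. ennreal (g x powr r) \<partial>M)"
proof -
  note g(1)[measurable]
  define N where "N = family_max F A"
  obtain K :: "int set" where K: "finite K"
    "\<And>x. x \<in> A ` F \<Longrightarrow> x > 0 \<Longrightarrow> \<exists>k\<in>K. 2 powr real_of_int k < x \<and> x \<le> 2 * 2 powr real_of_int k"
    using dyadic_level_exists[of "A ` F"] F(1) by auto
  define e where "e k = (2::real) powr real_of_int k" for k :: int
  have e: "e k > 0" for k by (simp add: e_def)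
  define \<Omega> where "\<Omega> k = \<Union>{Q\<in>F. e k < A Q}" for k
  define T where "T k = {x\<in>space M. e k / 2 < g x}" for k
  have \<Omega>[measurable]: "\<Omega> k \<in> sets M" for k using F unfolding \<Omega>_def by (intro sets.finite_Union) auto
  have T[measurable]: "T k \<in> sets M" for k unfolding T_def by measurable
  have 1: "N x powr r \<le> (\<Sum>k\<in>K. 2 powr r * e k powr r * indicator (\<Omega> k) x)" for x
  proof (cases "N x > 0")
    case False
    then show ?thesis using family_max_nonneg[OF F(1), of A x] e r
      by (auto simp: N_def intro!: sum_nonneg)
  next
    case True
    then obtain Q where Q: "Q \<in> F" "x \<in> Q" "A Q = N x"
      using family_max_attained[OF F(1)] unfolding N_def by metis
    then obtain k where k: "k \<in> K" "e k < N x" "N x \<le> 2 * e k" using K(2)[OF imageI[OF Q(1), of A]] True unfolding e_def by auto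
    have "N x powr r \<le> (2 * e k) powr r" using k True r by (intro powr_mono2) auto
    also have "\<dots> = 2 powr r * e k powr r * indicator (\<Omega> k) x"
      using Q k e[of k] by (auto simp: \<Omega>_def powr_mult indicator_def)
    also have "\<dots> \<le> (\<Sum>k\<in>K. 2 powr r * e k powr r * indicator (\<Omega> k) x)"
      using k K by (intro member_le_sum[of k K "\<lambda>k. 2 powr r * e k powr r * indicator (\<Omega> k) x"]) auto
    finally show ?thesis .
  qed
  have 2: "ennreal (e k) * emeasure M (\<Omega> k) \<le> 2 * (\<integral>\<^sup>+x\<in>T k. ennreal (g x) \<partial>M)" for k
  proof -
    have "ennreal (e k) * emeasure M (\<Omega> k) = 2 * (ennreal (e k / 2) * emeasure M (\<Omega> k))"
      using e[of k] by (simp add: mult.assoc[symmetric] ennreal_mult''[symmetric] numeral_mult_ennreal)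
    also have "\<dots> \<le> 2 * (\<integral>\<^sup>+x\<in>T k. ennreal (g x) \<partial>M)"
      using nested_weak_type[OF F g fin A, of "e k / 2"] e[of k]
      by (intro mult_left_mono) (auto simp: \<Omega>_def T_def)
    finally show ?thesis .
  qed
  have 3: "(\<Sum>k\<in>K. 2 powr r * 2 * e k powr (r - 1) * (g x * indicator (T k) x))
             \<le> maximal_const r * g x powr r" for x
  proof -
    have "(\<Sum>k\<in>K. 2 powr r * 2 * e k powr (r - 1) * (g x * indicator (T k) x))
        \<le> 2 powr r * 2 * g x * (\<Sum>k\<in>{k\<in>K. e k < 2 * g x}. e k powr (r - 1))"
    proof -
      have "(\<Sum>k\<in>K. 2 powr r * 2 * e k powr (r - 1) * (g x * indicator (T k) x))
         \<le> (\<Sum>k\<in>K. if e k < 2 * g x then 2 powr r * 2 * g x * e k powr (r - 1) else 0)"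
        using g(2)[of x] by (intro sum_mono) (auto simp: T_def indicator_def)
      also have "\<dots> = 2 powr r * 2 * g x * (\<Sum>k\<in>{k\<in>K. e k < 2 * g x}. e k powr (r - 1))"
        using K(1) by (simp add: sum.If_cases sum_distrib_left Int_def)
      finally show ?thesis .
    qed
    also have "\<dots> \<le> 2 powr r * 2 * g x * ((2 * g x) powr (r - 1) / (1 - 2 powr (-(r - 1))))"
      unfolding e_def using K(1) g(2)[of x] r by (intro mult_left_mono sum_dyadic_below_le) auto
    also have "\<dots> = maximal_const r * g x powr r"
    proof (cases "g x = 0")
      case False
      then have "g x > 0" using g(2)[of x] by simp
      moreover have "(4::real) powr r = 2 powr r * 2 powr r" by (simp add: powr_mult[symmetric])
      ultimately show ?thesis by (simp add: maximal_const_def powr_mult powr_diff)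
    qed (use r in auto)
    finally show ?thesis .
  qed
  have "(\<integral>\<^sup>+x. ennreal (N x powr r) \<partial>M) \<le> (\<integral>\<^sup>+x. (\<Sum>k\<in>K. ennreal (2 powr r * e k powr r) * indicator (\<Omega> k) x) \<partial>M)"
  proof (intro nn_integral_mono)
    fix x
    have "(\<Sum>k\<in>K. ennreal (2 powr r * e k powr r) * indicator (\<Omega> k) x)
        = ennreal (\<Sum>k\<in>K. 2 powr r * e k powr r * indicator (\<Omega> k) x)"
      by (subst sum_ennreal[symmetric]) (auto simp: ennreal_mult' ennreal_indicator intro!: sum.cong)
    then show "ennreal (N x powr r) \<le> (\<Sum>k\<in>K. ennreal (2 powr r * e k powr r) * indicator (\<Omega> k) x)"
      using 1[of x] by (simp add: ennreal_leI)
  qed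
  also have "\<dots> = (\<Sum>k\<in>K. ennreal (2 powr r * e k powr r) * emeasure M (\<Omega> k))"
    by (subst nn_integral_sum) (auto simp: nn_integral_cmult)
  also have "\<dots> = (\<Sum>k\<in>K. ennreal (2 powr r * e k powr (r - 1)) * (ennreal (e k) * emeasure M (\<Omega> k)))"
  proof (intro sum.cong refl)
    fix k
    have "2 powr r * e k powr r = 2 powr r * e k powr (r - 1) * e k"
      using e[of k] by (simp add: powr_diff)
    then show "ennreal (2 powr r * e k powr r) * emeasure M (\<Omega> k)
       = ennreal (2 powr r * e k powr (r - 1)) * (ennreal (e k) * emeasure M (\<Omega> k))"
      by (simp add: ennreal_mult' mult.assoc)
  qed
  also have "\<dots> \<le> (\<Sum>k\<in>K. ennreal (2 powr r * e k powr (r - 1)) * (2 * (\<integral>\<^sup>+x\<in>T k. ennreal (g x) \<partial>M)))"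
    by (intro sum_mono mult_left_mono 2) auto
  also have "\<dots> = (\<Sum>k\<in>K. ennreal (2 powr r * 2 * e k powr (r - 1)) * (\<integral>\<^sup>+x\<in>T k. ennreal (g x) \<partial>M))"
  proof (intro sum.cong refl)
    fix k
    have "ennreal (2 powr r * 2 * e k powr (r - 1)) = ennreal (2 powr r * e k powr (r - 1)) * 2"
      using ennreal_mult''[of 2 "2 powr r * e k powr (r - 1)"] by (simp only: mult.assoc mult.commute[of _ 2]) (simp add: mult.commute)
    then show "ennreal (2 powr r * e k powr (r - 1)) * (2 * (\<integral>\<^sup>+x\<in>T k. ennreal (g x) \<partial>M))
      = ennreal (2 powr r * 2 * e k powr (r - 1)) * (\<integral>\<^sup>+x\<in>T k. ennreal (g x) \<partial>M)"
      by (simp only: mult.assoc)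
  qed
  also have "\<dots> = (\<integral>\<^sup>+x. (\<Sum>k\<in>K. ennreal (2 powr r * 2 * e k powr (r - 1)) * (ennreal (g x) * indicator (T k) x)) \<partial>M)"
    by (subst nn_integral_sum) (auto simp: nn_integral_cmult)
  also have "\<dots> \<le> (\<integral>\<^sup>+x. ennreal (maximal_const r) * ennreal (g x powr r) \<partial>M)"
  proof (intro nn_integral_mono)
    fix x
    have "(\<Sum>k\<in>K. ennreal (2 powr r * 2 * e k powr (r - 1)) * (ennreal (g x) * indicator (T k) x))
        = ennreal (\<Sum>k\<in>K. 2 powr r * 2 * e k powr (r - 1) * (g x * indicator (T k) x))"
      using g(2)[of x]
      by (subst sum_ennreal[symmetric]) (auto simp: indicator_def ennreal_mult'' intro!: sum.cong)
    also have "\<dots> \<le> ennreal (maximal_const r * g x powr r)" by (rule ennreal_leI[OF 3])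
    finally show "(\<Sum>k\<in>K. ennreal (2 powr r * 2 * e k powr (r - 1)) * (ennreal (g x) * indicator (T k) x))
        \<le> ennreal (maximal_const r) * ennreal (g x powr r)"
      by (simp add: ennreal_mult'')
  qed
  also have "\<dots> = ennreal (maximal_const r) * (\<integral>\<^sup>+x. ennreal (g x powr r) \<partial>M)"
    by (intro nn_integral_cmult) measurable
  finally show ?thesis unfolding N_def .
qed

section \<open>Carleson embedding\<close>

text \<open>\<open>2 powr q\<close> rounds the product of averages up to a dyadic level, the maximal
  constants come through Hoelder, and \<open>1 - 2 powr (-p)\<close> from summing the
  \<open>p\<close>-th powers of levels below a given value. The outer power \<open>q / p\<close>
  passes from exponent \<open>p\<close> to \<open>q\<close>.\<close>

definition carleson_const :: "'i set \<Rightarrow> ('i \<Rightarrow> real) \<Rightarrow> real \<Rightarrow> real \<Rightarrow> real" where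
  "carleson_const I P p q =
     2 powr q * ((\<Prod>i\<in>I. maximal_const (P i) powr (p / P i)) / (1 - 2 powr (-p))) powr (q / p)"

text \<open>The \<open>p / P i\<close> sum to 1, so giving each factor
  \<open>\<sigma> i x powr (p / P i)\<close> of the density to the \<open>i\<close>-th maximal
  function produces the form that Hoelder needs; each factor is then a maximal inequality for the
  density \<open>\<sigma> i\<close>.\<close>

lemma nn_integral_prod_family_max_le:
  fixes \<sigma> g :: "'i \<Rightarrow> 'a \<Rightarrow> real" and A :: "'i \<Rightarrow> 'a set \<Rightarrow> real"
  assumes I: "finite I" "I \<noteq> {}" "\<And>i. i \<in> I \<Longrightarrow> P i > 1" "(\<Sum>i\<in>I. 1 / P i) = 1 / p" "p > 0"
    and F: "finite F" "F \<subseteq> sets M" "nested F"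
    and \<sigma>: "\<And>i. i \<in> I \<Longrightarrow> \<sigma> i \<in> borel_measurable M" "\<And>i x. i \<in> I \<Longrightarrow> \<sigma> i x \<ge> 0"
    and g: "\<And>i. i \<in> I \<Longrightarrow> g i \<in> borel_measurable M" "\<And>i x. i \<in> I \<Longrightarrow> g i x \<ge> 0"
    and fin: "\<And>i Q. i \<in> I \<Longrightarrow> Q \<in> F \<Longrightarrow> (\<integral>\<^sup>+x\<in>Q. ennreal (\<sigma> i x) \<partial>M) < \<infinity>"
    and A: "\<And>i Q. i \<in> I \<Longrightarrow> Q \<in> F \<Longrightarrow>
      ennreal (A i Q) * (\<integral>\<^sup>+x\<in>Q. ennreal (\<sigma> i x) \<partial>M) \<le> (\<integral>\<^sup>+x\<in>Q. ennreal (g i x) * ennreal (\<sigma> i x) \<partial>M)"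
    and G: "\<And>i. i \<in> I \<Longrightarrow> G i \<ge> 0"
      "\<And>i. i \<in> I \<Longrightarrow> (\<integral>\<^sup>+x. ennreal (g i x powr P i) * ennreal (\<sigma> i x) \<partial>M) \<le> ennreal (G i)"
  shows "(\<integral>\<^sup>+x. ennreal ((\<Prod>i\<in>I. family_max F (A i) x) powr p * (\<Prod>i\<in>I. \<sigma> i x powr (p / P i))) \<partial>M)
    \<le> ennreal ((\<Prod>i\<in>I. maximal_const (P i) powr (p / P i)) * (\<Prod>i\<in>I. G i powr (p / P i)))"
proof -
  define N where "N i = family_max F (A i)" for i
  have N0: "N i x \<ge> 0" for i x unfolding N_def by (rule family_max_nonneg[OF F(1)])
  have Nm[measurable]: "N i \<in> borel_measurable M" for i
    unfolding N_def by (rule borel_measurable_family_max[OF F(1,2)])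
  have P: "P i > 0" if "i \<in> I" for i using I(3)[OF that] by simp
  have max: "(\<integral>\<^sup>+x. ennreal (N i x powr P i * \<sigma> i x) \<partial>M) \<le> ennreal (maximal_const (P i) * G i)" if i: "i \<in> I" for i
  proof -
    note \<sigma>(1)[OF i, measurable] g(1)[OF i, measurable]
    \<comment> \<open>For this measure, assumption \<open>A\<close> bounds \<open>A i Q\<close> by
      the average of \<open>g i\<close> over \<open>Q\<close>.\<close>
    let ?D = "density M (\<lambda>x. ennreal (\<sigma> i x))"
    have "(\<integral>\<^sup>+x. ennreal (N i x powr P i * \<sigma> i x) \<partial>M) = (\<integral>\<^sup>+x. ennreal (\<sigma> i x) * ennreal (N i x powr P i) \<partial>M)"
      using \<sigma>(2)[OF i] by (intro nn_integral_cong) (simp add: ennreal_mult'' mult.commute)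
    also have "\<dots> = (\<integral>\<^sup>+x. ennreal (N i x powr P i) \<partial>?D)" by (rule nn_integral_density[symmetric]) measurable
    also have "\<dots> \<le> ennreal (maximal_const (P i)) * (\<integral>\<^sup>+x. ennreal (g i x powr P i) \<partial>?D)"
      unfolding N_def
    proof (rule nested_maximal_inequality)
      fix Q assume Q: "Q \<in> F"
      then have Qm: "Q \<in> sets M" using F(2) by auto
      have em: "emeasure ?D Q = (\<integral>\<^sup>+x\<in>Q. ennreal (\<sigma> i x) \<partial>M)" using Qm by (simp add: emeasure_density)
      then show "emeasure ?D Q < \<infinity>" using fin[OF i Q] by simp
      have "(\<integral>\<^sup>+x\<in>Q. ennreal (g i x) \<partial>?D) = (\<integral>\<^sup>+x. ennreal (\<sigma> i x) * (ennreal (g i x) * indicator Q x) \<partial>M)"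
        using Qm by (intro nn_integral_density borel_measurable_times_ennreal borel_measurable_indicator) auto
      also have "\<dots> = (\<integral>\<^sup>+x\<in>Q. ennreal (g i x) * ennreal (\<sigma> i x) \<partial>M)"
        by (intro nn_integral_cong) (simp add: ac_simps)
      finally show "ennreal (A i Q) * emeasure ?D Q \<le> (\<integral>\<^sup>+x\<in>Q. ennreal (g i x) \<partial>?D)"
        using A[OF i Q] em by simp
    qed (use F g(1)[OF i] g(2)[OF i] I(3)[OF i] in auto)
    also have "(\<integral>\<^sup>+x. ennreal (g i x powr P i) \<partial>?D) = (\<integral>\<^sup>+x. ennreal (\<sigma> i x) * ennreal (g i x powr P i) \<partial>M)"
      by (rule nn_integral_density) measurable
    also have "\<dots> \<le> ennreal (G i)" using G(2)[OF i] by (simp add: mult.commute)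
    finally show ?thesis using maximal_const_pos[OF I(3)[OF i]] by (simp add: ennreal_mult' mult_left_mono)
  qed
  have "(\<Sum>i\<in>I. p / P i) = p * (\<Sum>i\<in>I. 1 / P i)" by (simp add: sum_distrib_left)
  also have "\<dots> = 1" using I(4,5) by simp
  finally have \<theta>: "(\<Sum>i\<in>I. p / P i) = 1" .
  have "(\<integral>\<^sup>+x. ennreal ((\<Prod>i\<in>I. N i x) powr p * (\<Prod>i\<in>I. \<sigma> i x powr (p / P i))) \<partial>M)
      = (\<integral>\<^sup>+x. (\<Prod>i\<in>I. (N i x powr P i * \<sigma> i x) powr (p / P i)) \<partial>M)"
  proof (intro nn_integral_cong arg_cong[where f=ennreal])
    fix x
    have "(N i x powr P i * \<sigma> i x) powr (p / P i) = N i x powr p * \<sigma> i x powr (p / P i)" if "i \<in> I" for i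
      using P[OF that] by (simp add: powr_mult powr_powr \<sigma>(2)[OF that])
    then show "(\<Prod>i\<in>I. N i x) powr p * (\<Prod>i\<in>I. \<sigma> i x powr (p / P i)) = (\<Prod>i\<in>I. (N i x powr P i * \<sigma> i x) powr (p / P i))"
      by (simp add: prod.distrib prod_powr_distrib N0)
  qed
  also have "\<dots> \<le> ennreal (\<Prod>i\<in>I. (maximal_const (P i) * G i) powr (p / P i))"
    using I P \<theta> \<sigma> max G(1) maximal_const_pos[OF I(3)] N0
    by (intro nn_integral_prod_powr_le borel_measurable_times powr_real_measurable Nm borel_measurable_const)
      (simp_all add: less_imp_le)
  also have "(\<Prod>i\<in>I. (maximal_const (P i) * G i) powr (p / P i))
      = (\<Prod>i\<in>I. maximal_const (P i) powr (p / P i)) * (\<Prod>i\<in>I. G i powr (p / P i))"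
    unfolding prod.distrib[symmetric]
    by (intro prod.cong refl powr_mult)
  finally show ?thesis unfolding N_def .
qed

text \<open>At each level the sets with a large product lie below disjoint maximal ones, and
  \<open>B\<close> converts their \<open>\<mu>\<close>-mass into \<open>\<nu>\<close> of those. The
  maximal sets lie where the product of maximal functions exceeds the level, so summing over levels
  reassembles an integral of its \<open>p\<close>-th power.\<close>

theorem carleson_embedding:
  fixes \<sigma> g :: "'i \<Rightarrow> 'a \<Rightarrow> real" and A :: "'i \<Rightarrow> 'a set \<Rightarrow> real" and \<mu> \<nu> :: "'a set \<Rightarrow> real"
  assumes I: "finite I" "I \<noteq> {}" "\<And>i. i \<in> I \<Longrightarrow> P i > 1" "(\<Sum>i\<in>I. 1 / P i) = 1 / p" "p > 0" "p \<le> q"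
    and F: "finite F" "F \<subseteq> sets M" "nested F"
    and \<sigma>: "\<And>i. i \<in> I \<Longrightarrow> \<sigma> i \<in> borel_measurable M" "\<And>i x. i \<in> I \<Longrightarrow> \<sigma> i x \<ge> 0"
    and g: "\<And>i. i \<in> I \<Longrightarrow> g i \<in> borel_measurable M" "\<And>i x. i \<in> I \<Longrightarrow> g i x \<ge> 0"
    and fin: "\<And>i Q. i \<in> I \<Longrightarrow> Q \<in> F \<Longrightarrow> (\<integral>\<^sup>+x\<in>Q. ennreal (\<sigma> i x) \<partial>M) < \<infinity>"
    and A: "\<And>i Q. i \<in> I \<Longrightarrow> Q \<in> F \<Longrightarrow> A i Q \<ge> 0" "\<And>i Q. i \<in> I \<Longrightarrow> Q \<in> F \<Longrightarrow>
      ennreal (A i Q) * (\<integral>\<^sup>+x\<in>Q. ennreal (\<sigma> i x) \<partial>M) \<le> (\<integral>\<^sup>+x\<in>Q. ennreal (g i x) * ennreal (\<sigma> i x) \<partial>M)"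
    and G: "\<And>i. i \<in> I \<Longrightarrow> G i \<ge> 0"
      "\<And>i. i \<in> I \<Longrightarrow> (\<integral>\<^sup>+x. ennreal (g i x powr P i) * ennreal (\<sigma> i x) \<partial>M) \<le> ennreal (G i)"
    and \<mu>: "\<And>Q. Q \<in> F \<Longrightarrow> \<mu> Q \<ge> 0"
    and \<nu>: "\<And>Q. Q \<in> F \<Longrightarrow> \<nu> Q \<ge> 0"
      "\<And>Q. Q \<in> F \<Longrightarrow> ennreal (\<nu> Q) \<le> (\<integral>\<^sup>+x\<in>Q. ennreal (\<Prod>i\<in>I. \<sigma> i x powr (p / P i)) \<partial>M)"
    and B: "B \<ge> 0" "\<And>R. R \<in> F \<Longrightarrow> (\<Sum>Q\<in>{Q\<in>F. Q \<subseteq> R}. \<mu> Q) \<le> B * \<nu> R powr (q / p)"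
  shows "(\<Sum>Q\<in>F. \<mu> Q * (\<Prod>i\<in>I. A i Q) powr q)
           \<le> carleson_const I P p q * B * (\<Prod>i\<in>I. G i powr (q / P i))"
proof -
  have q: "q > 0" "q / p \<ge> 1" using I by auto
  define a where "a Q = (\<Prod>i\<in>I. A i Q)" for Q
  have a0: "a Q \<ge> 0" if "Q \<in> F" for Q unfolding a_def using A(1) that by (intro prod_nonneg) auto
  define D where "D = (\<Prod>i\<in>I. maximal_const (P i) powr (p / P i))"
  define \<Gamma> where "\<Gamma> = (\<Prod>i\<in>I. G i powr (p / P i))"
  have D\<Gamma>: "D \<ge> 0" "\<Gamma> \<ge> 0" unfolding D_def \<Gamma>_def by (auto intro: prod_nonneg)
  define c where "c = 1 - 2 powr (-p)"
  have c: "c > 0" using I by (simp add: c_def powr_less_one)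
  define w where "w x = (\<Prod>i\<in>I. \<sigma> i x powr (p / P i))" for x
  have w0: "w x \<ge> 0" for x unfolding w_def by (auto intro: prod_nonneg)
  have w[measurable]: "w \<in> borel_measurable M" unfolding w_def[abs_def]
    using \<sigma>(1) by (intro borel_measurable_prod powr_real_measurable) auto
  obtain K :: "int set" where K: "finite K"
    "\<And>x. x \<in> a ` F \<Longrightarrow> x > 0 \<Longrightarrow> \<exists>k\<in>K. 2 powr real_of_int k < x \<and> x \<le> 2 * 2 powr real_of_int k"
    using dyadic_level_exists[of "a ` F"] F(1) by auto
  define e where "e k = (2::real) powr real_of_int k" for k :: int
  have e: "e k > 0" for k by (simp add: e_def)
  have "\<forall>k. \<exists>H. H \<subseteq> {Q\<in>F. e k < a Q} \<and> disjoint H \<and> (\<forall>Q\<in>{Q\<in>F. e k < a Q}. \<exists>R\<in>H. Q \<subseteq> R)"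
  proof
    fix k
    have "finite {Q\<in>F. e k < a Q}" "nested {Q\<in>F. e k < a Q}"
      using F(1) nested_subset[OF F(3)] by auto
    then show "\<exists>H. H \<subseteq> {Q\<in>F. e k < a Q} \<and> disjoint H \<and> (\<forall>Q\<in>{Q\<in>F. e k < a Q}. \<exists>R\<in>H. Q \<subseteq> R)"
      using nested_maximal_cover by meson
  qed
  from choice[OF this] obtain H where "\<forall>k. H k \<subseteq> {Q\<in>F. e k < a Q} \<and> disjoint (H k) \<and>
      (\<forall>Q\<in>{Q\<in>F. e k < a Q}. \<exists>R\<in>H k. Q \<subseteq> R)"
    by (elim exE)
  then have H: "\<And>k. H k \<subseteq> {Q\<in>F. e k < a Q}" "\<And>k. disjoint (H k)"
    "\<And>k Q. Q \<in> F \<Longrightarrow> e k < a Q \<Longrightarrow> \<exists>R\<in>H k. Q \<subseteq> R"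
    by simp_all
  have HF: "H k \<subseteq> F" for k using H(1) by auto
  have Hfin: "finite (H k)" for k using HF F(1) by (rule finite_subset)
  define n where "n k = (\<Sum>R\<in>H k. \<nu> R)" for k
  have n0: "n k \<ge> 0" for k unfolding n_def using \<nu>(1) HF by (intro sum_nonneg) auto
  have level: "(\<Sum>Q\<in>{Q\<in>F. e k < a Q}. \<mu> Q) \<le> B * n k powr (q / p)" for k
  proof -
    \<comment> \<open>Every \<open>Q\<close> of the level lies below some \<open>R\<close> in
      \<open>H k\<close>; since \<open>\<mu>\<close> is nonnegative, summing over all pairs can only
      enlarge the sum.\<close>
    have "(\<Sum>Q\<in>{Q\<in>F. e k < a Q}. \<mu> Q) \<le> (\<Sum>(R, Q)\<in>(SIGMA R:H k. {Q\<in>F. Q \<subseteq> R}). \<mu> Q)"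
      using H(3)[of _ k] F(1) \<mu> Hfin by (intro sum_le_included[where i=snd]) force+
    also have "\<dots> = (\<Sum>R\<in>H k. \<Sum>Q\<in>{Q\<in>F. Q \<subseteq> R}. \<mu> Q)"
      using F(1) Hfin by (intro sum.Sigma[symmetric]) auto
    also have "\<dots> \<le> (\<Sum>R\<in>H k. B * \<nu> R powr (q / p))" using B(2) HF by (intro sum_mono) auto
    \<comment> \<open>First use of \<open>p \<le> q\<close>: superadditivity over the maximal sets
      of one level.\<close>
    also have "\<dots> \<le> B * n k powr (q / p)"
      unfolding sum_distrib_left[symmetric] n_def using HF[of k] \<nu>(1) q
      by (intro mult_left_mono[OF _ B(1)] sum_powr_le_powr_sum Hfin) auto
    finally show ?thesis .
  qed
  \<comment> \<open>The product of the maximal functions, not a maximal function of the products: it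
    still dominates \<open>a\<close> and separates into factors for Hoelder.\<close>
  define N where "N x = (\<Prod>i\<in>I. family_max F (A i) x)" for x
  have N0: "N x \<ge> 0" for x unfolding N_def by (intro prod_nonneg ballI family_max_nonneg F)
  have N: "a Q \<le> N x" if "Q \<in> F" "x \<in> Q" for Q x
    unfolding a_def N_def using that A(1) F(1) by (intro prod_mono) (auto intro: family_max_ge)
  have "ennreal (\<Sum>k\<in>K. e k powr p * n k) = (\<Sum>k\<in>K. ennreal (e k powr p) * (\<Sum>R\<in>H k. ennreal (\<nu> R)))"
  proof -
    have "ennreal (e k powr p * n k) = ennreal (e k powr p) * (\<Sum>R\<in>H k. ennreal (\<nu> R))" for k
      unfolding n_def using \<nu>(1) HF[of k] by (subst sum_ennreal) (auto simp: ennreal_mult')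
    then show ?thesis using n0 by (subst sum_ennreal[symmetric]) auto
  qed
  also have "\<dots> \<le> (\<Sum>k\<in>K. ennreal (e k powr p) * (\<integral>\<^sup>+x\<in>\<Union>(H k). ennreal (w x) \<partial>M))"
  proof (intro sum_mono mult_left_mono)
    fix k
    have "(\<Sum>R\<in>H k. ennreal (\<nu> R)) \<le> (\<Sum>R\<in>H k. \<integral>\<^sup>+x\<in>R. ennreal (w x) \<partial>M)"
      unfolding w_def using HF[of k] \<nu>(2) by (intro sum_mono) auto
    also have "\<dots> = (\<integral>\<^sup>+x\<in>\<Union>(H k). ennreal (w x) \<partial>M)"
      using HF F by (intro sum_set_nn_integral_disjoint Hfin H(2)) auto
    finally show "(\<Sum>R\<in>H k. ennreal (\<nu> R)) \<le> (\<integral>\<^sup>+x\<in>\<Union>(H k). ennreal (w x) \<partial>M)" .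
  qed auto
  also have "\<dots> = (\<integral>\<^sup>+x. (\<Sum>k\<in>K. ennreal (e k powr p) * (ennreal (w x) * indicator (\<Union>(H k)) x)) \<partial>M)"
  proof -
    have "\<Union>(H k) \<in> sets M" for k using Hfin HF F(2) by (intro sets.finite_Union) auto
    then show ?thesis by (subst nn_integral_sum) (auto simp: nn_integral_cmult)
  qed
  also have "\<dots> \<le> (\<integral>\<^sup>+x. ennreal (1 / c) * ennreal (N x powr p * w x) \<partial>M)"
  proof (intro nn_integral_mono)
    fix x
    have "(\<Sum>k\<in>K. ennreal (e k powr p) * (ennreal (w x) * indicator (\<Union>(H k)) x))
        = ennreal (\<Sum>k\<in>K. e k powr p * (w x * indicator (\<Union>(H k)) x))"
      using w0 by (subst sum_ennreal[symmetric]) (auto simp: indicator_def ennreal_mult'' intro!: sum.cong)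
    also have "(\<Sum>k\<in>K. e k powr p * (w x * indicator (\<Union>(H k)) x))
        \<le> (\<Sum>k\<in>K. if e k < N x then e k powr p * w x else 0)"
    proof (rule sum_mono)
      fix k
      have "e k < N x" if "x \<in> \<Union>(H k)" using that H(1)[of k] N by fastforce
      then show "e k powr p * (w x * indicator (\<Union>(H k)) x) \<le> (if e k < N x then e k powr p * w x else 0)"
        using w0[of x] by (auto simp: indicator_def)
    qed
    also have "\<dots> = (\<Sum>k\<in>{k\<in>K. e k < N x}. e k powr p) * w x"
      using K(1) by (simp add: sum.If_cases sum_distrib_right Int_def)
    also have "\<dots> \<le> (N x powr p / c) * w x"
      unfolding e_def c_def using I K(1) N0 w0 by (intro mult_right_mono sum_dyadic_below_le) auto
    finally show "(\<Sum>k\<in>K. ennreal (e k powr p) * (ennreal (w x) * indicator (\<Union>(H k)) x))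
        \<le> ennreal (1 / c) * ennreal (N x powr p * w x)"
      using c by (simp add: ennreal_mult'[symmetric] ennreal_leI)
  qed
  also have "\<dots> = ennreal (1 / c) * (\<integral>\<^sup>+x. ennreal (N x powr p * w x) \<partial>M)"
    unfolding N_def[abs_def] using F
    by (intro nn_integral_cmult measurable_compose[OF _ measurable_ennreal] borel_measurable_times w
        powr_real_measurable borel_measurable_prod borel_measurable_family_max) auto
  also have "\<dots> \<le> ennreal (1 / c) * ennreal (D * \<Gamma>)"
    unfolding N_def w_def D_def \<Gamma>_def
    by (intro mult_left_mono nn_integral_prod_family_max_le[OF I(1-5) F \<sigma> g fin A(2) G]) auto
  finally have "ennreal (\<Sum>k\<in>K. e k powr p * n k) \<le> ennreal (D * \<Gamma> / c)"
    using c by (simp add: ennreal_mult'[symmetric])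
  then have sum_le: "(\<Sum>k\<in>K. e k powr p * n k) \<le> D * \<Gamma> / c" using D\<Gamma> c by simp
  have "(\<Sum>Q\<in>F. \<mu> Q * a Q powr q) \<le> (\<Sum>Q\<in>F. \<Sum>k\<in>K. 2 powr q * e k powr q * (if e k < a Q then \<mu> Q else 0))"
  proof (rule sum_mono)
    fix Q assume Q: "Q \<in> F"
    show "\<mu> Q * a Q powr q \<le> (\<Sum>k\<in>K. 2 powr q * e k powr q * (if e k < a Q then \<mu> Q else 0))"
    proof (cases "a Q > 0")
      case False
      then show ?thesis using a0[OF Q] \<mu>[OF Q] by (auto intro!: sum_nonneg)
    next
      case True
      then obtain k where k: "k \<in> K" "e k < a Q" "a Q \<le> 2 * e k"
        using K(2)[OF imageI[OF Q]] unfolding e_def by auto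
      have "\<mu> Q * a Q powr q \<le> \<mu> Q * (2 * e k) powr q"
        using k True q \<mu>[OF Q] by (intro mult_left_mono powr_mono2) auto
      also have "\<dots> = 2 powr q * e k powr q * (if e k < a Q then \<mu> Q else 0)"
        using k e[of k] by (simp add: powr_mult)
      also have "\<dots> \<le> (\<Sum>k\<in>K. 2 powr q * e k powr q * (if e k < a Q then \<mu> Q else 0))"
        using k K \<mu>[OF Q]
        by (intro member_le_sum[of k K "\<lambda>k. 2 powr q * e k powr q * (if e k < a Q then \<mu> Q else 0)"]) auto
      finally show ?thesis .
    qed
  qed
  also have "\<dots> = (\<Sum>k\<in>K. 2 powr q * e k powr q * (\<Sum>Q\<in>{Q\<in>F. e k < a Q}. \<mu> Q))"
    using F(1) by (subst sum.swap) (simp add: sum_distrib_left[symmetric] sum.If_cases Int_def)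
  also have "\<dots> \<le> (\<Sum>k\<in>K. 2 powr q * e k powr q * (B * n k powr (q / p)))"
    by (intro sum_mono mult_left_mono level) auto
  also have "\<dots> = 2 powr q * B * (\<Sum>k\<in>K. (e k powr p * n k) powr (q / p))"
    using I(5) n0 by (simp add: sum_distrib_left powr_mult powr_powr ac_simps)
  \<comment> \<open>Second use of \<open>p \<le> q\<close>: superadditivity over the levels.\<close>
  also have "\<dots> \<le> 2 powr q * B * (\<Sum>k\<in>K. e k powr p * n k) powr (q / p)"
    using B(1) n0 K(1) q by (intro mult_left_mono sum_powr_le_powr_sum) auto
  also have "\<dots> \<le> 2 powr q * B * (D * \<Gamma> / c) powr (q / p)"
    using B(1) n0 q sum_le by (intro mult_left_mono powr_mono2) (auto intro!: sum_nonneg)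
  also have "(D * \<Gamma> / c) powr (q / p) = (D / c) powr (q / p) * \<Gamma> powr (q / p)"
    using D\<Gamma> c by (simp add: powr_mult powr_divide)
  also have "\<Gamma> powr (q / p) = (\<Prod>i\<in>I. G i powr (q / P i))"
    unfolding \<Gamma>_def using I(5) by (simp add: prod_powr_distrib powr_powr)
  finally show ?thesis unfolding a_def carleson_const_def D_def c_def by (simp add: ac_simps)
qed

section \<open>Dyadic grids\<close>

text \<open>Treats the closed cubes of the definitions and the half-open cubes of the grids
  together; both agree with the closed box up to a null set.\<close>

definition cube_like :: "(real ^ 'n) set \<Rightarrow> bool" where
  "cube_like R \<longleftrightarrow> (\<exists>a l. l > 0 \<and> box a (a + (\<chi> i. l)) \<subseteq> R \<and> R \<subseteq> cbox a (a + (\<chi> i. l)))"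

lemma cubes_cube_like:
  fixes Q :: "(real ^ 'n) set"
  assumes "Q \<in> cubes"
  shows "cube_like Q"
proof -
  from assms obtain a l where "Q = cbox a (a + (\<chi> i. l))" "l > 0" unfolding cubes_def by auto
  then show ?thesis
    unfolding cube_like_def by (intro exI[of _ a] exI[of _ l]) (auto simp: mem_box_cart less_imp_le)
qed

text \<open>The floor encoding yields half-open cubes, so that each scale is a partition, and
  reduces nesting to integer division.\<close>

definition dyadic_cube :: "real ^ 'n \<Rightarrow> int \<Rightarrow> ('n \<Rightarrow> int) \<Rightarrow> (real ^ 'n) set" where
  "dyadic_cube s k z = {x. \<forall>i. \<lfloor>(x $ i - s $ i) / 2 powr real_of_int k\<rfloor> = z i}"

lemma measure_cube:
  fixes a :: "real ^ 'n"
  assumes "l \<ge> 0"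
  shows "measure lebesgue (cbox a (a + (\<chi> i. l))) = l ^ CARD('n)"
  using assms by (simp add: content_cbox_if_cart interval_eq_empty_cart not_less)

text \<open>The faces form a null set, and by completeness of \<open>lebesgue\<close> any part of
  them may be added or removed without losing measurability.\<close>

lemma cube_sandwich:
  fixes R :: "(real ^ 'n) set"
  assumes "box a (a + (\<chi> i. l)) \<subseteq> R" "R \<subseteq> cbox a (a + (\<chi> i. l))" "l > 0"
  shows "R \<in> sets lebesgue" "measure lebesgue R = l ^ CARD('n)"
    "(\<integral>\<^sup>+x\<in>R. f x \<partial>lebesgue) = (\<integral>\<^sup>+x\<in>cbox a (a + (\<chi> i. l)). f x \<partial>lebesgue)"
proof -
  let ?b = "a + (\<chi> i. l)"
  have null: "cbox a ?b - box a ?b \<in> null_sets lebesgue"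
    using negligible_frontier_interval[of a ?b] by (simp add: negligible_iff_null_sets)
  have sub: "cbox a ?b - R \<in> null_sets lebesgue"
    by (rule completion.complete2[OF _ null]) (use assms in auto)
  have R: "R = cbox a ?b - (cbox a ?b - R)" using assms by auto
  show *: "R \<in> sets lebesgue" by (subst R) (use sub in auto)
  have "measure lebesgue R = measure lebesgue (cbox a ?b)"
    by (subst R) (rule measure_Diff_null_set[OF _ sub], simp)
  then show "measure lebesgue R = l ^ CARD('n)" using measure_cube[of l a] assms(3) by simp
  have "AE x in lebesgue. x \<notin> cbox a ?b - R" using sub by (rule AE_not_in)
  then have "AE x in lebesgue. f x * indicator R x = f x * indicator (cbox a ?b) x"
    by eventually_elim (use assms in \<open>auto simp: indicator_def\<close>)
  then show "(\<integral>\<^sup>+x\<in>R. f x \<partial>lebesgue) = (\<integral>\<^sup>+x\<in>cbox a ?b. f x \<partial>lebesgue)"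
    by (rule nn_integral_cong_AE)
qed

lemma cube_like_closure:
  fixes R :: "(real ^ 'n) set"
  assumes "cube_like R"
  obtains Q where "Q \<in> cubes" "R \<subseteq> Q" "measure lebesgue Q = measure lebesgue R"
    "\<And>f. (\<integral>\<^sup>+x\<in>R. f x \<partial>lebesgue) = (\<integral>\<^sup>+x\<in>Q. f x \<partial>lebesgue)"
proof -
  from assms obtain a l where al: "l > 0" "box a (a + (\<chi> i. l)) \<subseteq> R" "R \<subseteq> cbox a (a + (\<chi> i. l))"
    unfolding cube_like_def by auto
  show thesis
    by (rule that[of "cbox a (a + (\<chi> i. l))"])
      (use al measure_cube[of l a] in \<open>auto simp: cubes_def cube_sandwich[OF al(2,3,1)]\<close>)
qed

lemma cube_like_sets:
  assumes "cube_like R"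
  shows "R \<in> sets lebesgue"
proof -
  from assms obtain a l where "l > 0" "box a (a + (\<chi> i. l)) \<subseteq> R" "R \<subseteq> cbox a (a + (\<chi> i. l))"
    unfolding cube_like_def by (elim exE conjE)
  then show ?thesis by (intro cube_sandwich(1))
qed

lemma cube_like_measure_pos:
  fixes R :: "(real ^ 'n) set"
  assumes "cube_like R"
  shows "measure lebesgue R > 0"
proof -
  from assms obtain a l where al: "l > 0" "box a (a + (\<chi> i. l)) \<subseteq> R" "R \<subseteq> cbox a (a + (\<chi> i. l))"
    unfolding cube_like_def by (elim exE conjE)
  show ?thesis unfolding cube_sandwich(2)[OF al(2,3,1)] using al(1) by simp
qed

lemma dyadic_cube_sandwich:
  fixes s :: "real ^ 'n"
  defines "a \<equiv> \<lambda>k z. \<chi> i. s $ i + real_of_int (z i) * 2 powr real_of_int k"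
  shows "box (a k z) (a k z + (\<chi> i. 2 powr real_of_int k)) \<subseteq> dyadic_cube s k z"
    and "dyadic_cube s k z \<subseteq> cbox (a k z) (a k z + (\<chi> i. 2 powr real_of_int k))"
proof -
  have *: "(\<lfloor>y / e\<rfloor> = w) = (real_of_int w * e \<le> y \<and> y < real_of_int w * e + e)" if "e > 0" for y e :: real and w :: int
    using that by (simp add: floor_eq_iff field_simps)
  have D: "dyadic_cube s k z = {x. \<forall>i. real_of_int (z i) * 2 powr real_of_int k \<le> x $ i - s $ i \<and>
      x $ i - s $ i < real_of_int (z i) * 2 powr real_of_int k + 2 powr real_of_int k}"
    unfolding dyadic_cube_def by (subst *) auto
  show "box (a k z) (a k z + (\<chi> i. 2 powr real_of_int k)) \<subseteq> dyadic_cube s k z"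
    unfolding D a_def by (auto simp: mem_box_cart less_imp_le algebra_simps)
  show "dyadic_cube s k z \<subseteq> cbox (a k z) (a k z + (\<chi> i. 2 powr real_of_int k))"
    unfolding D a_def by (auto simp: mem_box_cart less_imp_le algebra_simps)
qed

lemma dyadic_cube_like: "cube_like (dyadic_cube s k z)"
  unfolding cube_like_def using dyadic_cube_sandwich[where s=s and k=k and z=z]
  by (intro exI[of _ "\<chi> i. s $ i + real_of_int (z i) * 2 powr real_of_int k"] exI[of _ "2 powr real_of_int k"]) auto

lemma measure_dyadic_cube:
  fixes s :: "real ^ 'n"
  shows "measure lebesgue (dyadic_cube s k z) = (2 powr real_of_int k) ^ CARD('n)"
  using cube_sandwich(2)[OF dyadic_cube_sandwich] by simp

text \<open>The index of a point at the coarser scale is its finer index divided by a power of 2, so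
  all points of the smaller cube share one coarse index.\<close>

lemma dyadic_cube_subset:
  assumes "k \<le> k'" "dyadic_cube s k z \<inter> dyadic_cube s k' z' \<noteq> {}"
  shows "dyadic_cube s k z \<subseteq> dyadic_cube s k' z'"
proof
  define j where "j = nat (k' - k)"
  have k': "2 powr real_of_int k' = 2 powr real_of_int k * real_of_int (2 ^ j)"
    using assms(1) by (simp add: j_def powr_realpow[symmetric] powr_add[symmetric])
  have *: "\<lfloor>y / 2 powr real_of_int k'\<rfloor> = \<lfloor>y / 2 powr real_of_int k\<rfloor> div 2 ^ j" for y
    unfolding k' divide_divide_eq_left[symmetric] by (rule floor_divide_real_eq_div) simp
  obtain y where y: "y \<in> dyadic_cube s k z" "y \<in> dyadic_cube s k' z'" using assms(2) by auto
  fix x assume "x \<in> dyadic_cube s k z"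
  then show "x \<in> dyadic_cube s k' z'" using y unfolding dyadic_cube_def mem_Collect_eq * by metis
qed

text \<open>If both shifts failed, multiples of the side length \<open>e\<close> and of \<open>e\<close> shifted by \<open>2\<^sup>N / 3\<close> would be
  closer than \<open>e / 3\<close>, which is impossible since 3 does not divide a power of 2.\<close>

lemma one_third_shift:
  fixes a l :: real and k :: int and N :: nat
  assumes "l > 0" "3 * l < 2 powr real_of_int k" "k \<le> int N"
  shows "\<exists>t\<in>{0, 2 ^ N / 3}. \<lfloor>(a - t) / 2 powr real_of_int k\<rfloor> = \<lfloor>(a + l - t) / 2 powr real_of_int k\<rfloor>"
proof (rule ccontr)
  assume no: "\<not> ?thesis"
  define e where "e = 2 powr real_of_int k"
  have e: "e > 0" by (simp add: e_def)
  define j where "j = nat (int N - k)"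
  have N: "2 ^ N = e * real_of_int (2 ^ j)"
    using assms(3) by (simp add: e_def j_def powr_realpow[symmetric] powr_add[symmetric])
  \<comment> \<open>Different floors mean that a multiple of \<open>e\<close> separates the two end
    points.\<close>
  have cross: "\<exists>u::int. a - t < real_of_int u * e \<and> real_of_int u * e \<le> a + l - t"
    if "\<lfloor>(a - t) / e\<rfloor> \<noteq> \<lfloor>(a + l - t) / e\<rfloor>" for t
  proof (intro exI conjI)
    let ?u = "\<lfloor>(a + l - t) / e\<rfloor>"
    have "\<lfloor>(a - t) / e\<rfloor> \<le> ?u" using e assms(1) by (intro floor_mono divide_right_mono) auto
    then have "\<lfloor>(a - t) / e\<rfloor> < ?u" using that by simp
    then show "a - t < real_of_int ?u * e" using e by (simp add: floor_less_iff field_simps)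
    show "real_of_int ?u * e \<le> a + l - t" using e by (simp add: pos_le_divide_eq[symmetric])
  qed
  obtain u where u: "a < real_of_int u * e" "real_of_int u * e \<le> a + l"
    using cross[of 0] no by (auto simp: e_def)
  obtain w where w: "a - 2 ^ N / 3 < real_of_int w * e" "real_of_int w * e \<le> a + l - 2 ^ N / 3"
    using cross[of "2 ^ N / 3"] no by (auto simp: e_def)
  \<comment> \<open>\<open>d * e\<close> is three times the gap between \<open>u * e\<close> and
    \<open>w * e + 2 ^ N / 3\<close>, which lie in one interval of length \<open>l\<close>; as
    \<open>3 * l < e\<close>, the integer \<open>d\<close> must be 0.\<close>
  define d where "d = 3 * (w - u) + 2 ^ j"
  have "real_of_int d * e = 3 * (real_of_int w * e - real_of_int u * e) + 2 ^ N"
    unfolding N d_def by (simp add: algebra_simps)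
  moreover have "\<bar>3 * (W - U) + T\<bar> < 3 * l"
    if "a < U" "U \<le> a + l" "a - T / 3 < W" "W \<le> a + l - T / 3" for U W T :: real
  proof -
    have "3 * (W - U) + T < 3 * l" "- (3 * l) < 3 * (W - U) + T"
      using that by (simp_all add: field_simps)
    then show ?thesis by (simp add: abs_less_iff)
  qed
  ultimately have "\<bar>real_of_int d * e\<bar> < 3 * l" using u w by simp
  then have "\<bar>real_of_int d\<bar> * e < 1 * e"
    using assms(2) e unfolding e_def[symmetric] abs_mult by linarith
  then have "\<bar>real_of_int d\<bar> < 1" using e by (simp only: mult_less_cancel_right)
  then have "d = 0" by linarith
  then have "(2::int) ^ j mod 3 = 0" unfolding d_def by presburger
  moreover have "(2::int) ^ j mod 3 \<noteq> 0"
  proof (induction j)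
    case (Suc j)
    then show ?case unfolding power_Suc by presburger
  qed simp
  ultimately show False by simp
qed

text \<open>Only scales up to \<open>2\<^sup>N\<close> are used, so one shift serves all scales and nestedness is preserved.
  The bound on the indices covers all cubes of scale at least \<open>2\<close> to the power \<open>-N\<close> near the ball of radius \<open>N\<close>.\<close>

definition grid_shift :: "nat \<Rightarrow> 'n set \<Rightarrow> real ^ 'n" where
  "grid_shift N S = (\<chi> i. if i \<in> S then 2 ^ N / 3 else 0)"

definition grid :: "nat \<Rightarrow> 'n set \<Rightarrow> (real ^ 'n) set set" where
  "grid N S = (\<lambda>(k, z). dyadic_cube (grid_shift N S) k z) `
     ({- int N..int N} \<times> (UNIV \<rightarrow>\<^sub>E {- ((int N + 2 ^ N) * 2 ^ N + 1)..(int N + 2 ^ N) * 2 ^ N + 1}))"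

lemma finite_grid: "finite (grid N (S :: 'n::finite set))"
  unfolding grid_def by (intro finite_imageI finite_cartesian_product finite_PiE) auto

lemma grid_cube_like: "R \<in> grid N S \<Longrightarrow> cube_like R"
  unfolding grid_def using dyadic_cube_like by auto

lemma nested_grid: "nested (grid N S)"
  unfolding nested_def
proof (intro ballI)
  fix Q R assume "Q \<in> grid N S" "R \<in> grid N S"
  then obtain k z k' z' where "Q = dyadic_cube (grid_shift N S) k z" "R = dyadic_cube (grid_shift N S) k' z'"
    unfolding grid_def by auto
  then show "Q \<inter> R = {} \<or> Q \<subseteq> R \<or> R \<subseteq> Q"
    using dyadic_cube_subset[of k k' _ z z'] dyadic_cube_subset[of k' k _ z' z] by (cases "k \<le> k'") auto
qed

text \<open>The side of the grid cube is taken above \<open>3 * l\<close>, as the shift argument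
  demands, and at most \<open>6 * l\<close>, whence the base 6. That every large \<open>N\<close>
  works is what the later liminf relies on.\<close>

lemma cube_subset_grid:
  fixes Q :: "(real ^ 'n) set"
  assumes "Q \<in> cubes"
  obtains N0 where "\<And>N. N \<ge> N0 \<Longrightarrow> \<exists>S. \<exists>R\<in>grid N S. Q \<subseteq> R \<and> measure lebesgue R \<le> 6 ^ CARD('n) * measure lebesgue Q"
proof -
  obtain a l where Q: "Q = cbox a (a + (\<chi> i. l))" "l > 0" using assms by (auto simp: cubes_def)
  define k where "k = \<lfloor>log 2 (3 * l)\<rfloor> + 1"
  have "log 2 (3 * l) < real_of_int k" unfolding k_def by linarith
  then have k1: "3 * l < 2 powr real_of_int k" using Q(2) by (simp add: log_less_iff)
  have "real_of_int k - 1 \<le> log 2 (3 * l)" unfolding k_def by linarith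
  then have "2 powr (real_of_int k - 1) \<le> 3 * l" using Q(2) by (simp add: le_log_iff)
  then have k2: "2 powr real_of_int k \<le> 6 * l" by (simp add: powr_diff)
  define N0 where "N0 = nat (max \<bar>k\<bar> \<lceil>norm a\<rceil>)"
  show thesis
  proof (rule that[of N0])
    fix N assume N: "N0 \<le> N"
    then have kN: "- int N \<le> k" "k \<le> int N" and aN: "norm a \<le> real N" unfolding N0_def by linarith+
    have "\<forall>i. \<exists>t\<in>{0, 2 ^ N / 3}. \<lfloor>(a $ i - t) / 2 powr real_of_int k\<rfloor> = \<lfloor>(a $ i + l - t) / 2 powr real_of_int k\<rfloor>"
      using one_third_shift[OF Q(2) k1 kN(2)] by blast
    then obtain t where t: "\<And>i. t i \<in> {0, 2 ^ N / 3}"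
      "\<And>i. \<lfloor>(a $ i - t i) / 2 powr real_of_int k\<rfloor> = \<lfloor>(a $ i + l - t i) / 2 powr real_of_int k\<rfloor>" by metis
    \<comment> \<open>Each coordinate picks its own shift, which is why the grids are indexed by the
      set of shifted coordinates.\<close>
    define S where "S = {i. t i \<noteq> 0}"
    have gs: "grid_shift N S $ i = t i" for i using t(1)[of i] by (auto simp: grid_shift_def S_def)
    define z where "z i = \<lfloor>(a $ i - t i) / 2 powr real_of_int k\<rfloor>" for i
    let ?R = "dyadic_cube (grid_shift N S) k z"
    have "Q \<subseteq> ?R"
    proof
      fix x assume x: "x \<in> Q"
      have "\<lfloor>(x $ i - t i) / 2 powr real_of_int k\<rfloor> = z i" for i
      proof (rule antisym)
        have xi: "a $ i \<le> x $ i" "x $ i \<le> a $ i + l" using x by (auto simp: Q mem_box_cart)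
        show "z i \<le> \<lfloor>(x $ i - t i) / 2 powr real_of_int k\<rfloor>"
          unfolding z_def using xi by (intro floor_mono divide_right_mono) auto
        show "\<lfloor>(x $ i - t i) / 2 powr real_of_int k\<rfloor> \<le> z i"
          unfolding z_def t(2) using xi by (intro floor_mono divide_right_mono) auto
      qed
      then show "x \<in> ?R" by (simp add: dyadic_cube_def gs)
    qed
    moreover have "?R \<in> grid N S"
    proof -
      \<comment> \<open>The index range in \<open>grid\<close> comes from here: the shifted corner
        has coordinates of size at most \<open>N + 2 ^ N\<close>, dividing by the side multiplies by
        at most \<open>2 ^ N\<close>, and the 1 absorbs the floor.\<close>
      have "z i \<in> {- ((int N + 2 ^ N) * 2 ^ N + 1)..(int N + 2 ^ N) * 2 ^ N + 1}" for i
      proof -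
        define y where "y = (a $ i - t i) / 2 powr real_of_int k"
        have "\<bar>a $ i - t i\<bar> \<le> real N + 2 ^ N"
        proof -
          have "t i = 0 \<or> t i = 2 ^ N / 3" using t(1)[of i] by simp
          moreover have "(0::real) < 2 ^ N" by simp
          ultimately have "\<bar>t i\<bar> \<le> 2 ^ N" by linarith
          then show ?thesis using component_le_norm_cart[of a i] aN by linarith
        qed
        moreover have "1 / 2 powr real_of_int k \<le> 2 ^ N"
          using kN(1) by (simp add: powr_minus_divide[symmetric] powr_realpow[symmetric])
        ultimately have "\<bar>a $ i - t i\<bar> * (1 / 2 powr real_of_int k) \<le> (real N + 2 ^ N) * 2 ^ N"
          by (intro mult_mono) auto
        then have y: "\<bar>y\<bar> \<le> real_of_int ((int N + 2 ^ N) * 2 ^ N)" by (simp add: y_def)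
        define B where "B = (int N + 2 ^ N) * 2 ^ N"
        have "- (B + 1) \<le> \<lfloor>y\<rfloor>" "\<lfloor>y\<rfloor> \<le> B + 1" using y unfolding B_def[symmetric] by linarith+
        then show ?thesis unfolding z_def y_def[symmetric] B_def[symmetric] by simp
      qed
      then show ?thesis unfolding grid_def using kN by (intro image_eqI[of _ _ "(k, z)"]) (auto simp: PiE_def)
    qed
    moreover have "measure lebesgue ?R \<le> 6 ^ CARD('n) * measure lebesgue Q"
      unfolding measure_dyadic_cube Q(1) measure_cube[OF less_imp_le[OF Q(2)]] power_mult_distrib[symmetric]
      using k2 by (intro power_mono) auto
    ultimately show "\<exists>S. \<exists>R\<in>grid N S. Q \<subseteq> R \<and> measure lebesgue R \<le> 6 ^ CARD('n) * measure lebesgue Q" by blast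
  qed
qed

section \<open>Weights\<close>

lemma ennreal_epowr: "x \<ge> 0 \<Longrightarrow> ennreal x epowr a = ennreal (x powr a)"
  by (simp add: ennreal_powr_def)

lemma epowr_mono: "x \<le> y \<Longrightarrow> a \<ge> 0 \<Longrightarrow> x epowr a \<le> y epowr a"
  by (cases x; cases y) (auto simp: ennreal_powr_def powr_mono2 top_unique)

lemma epowr_mult: "a > 0 \<Longrightarrow> (x * y) epowr a = x epowr a * y epowr a"
  by (cases x; cases y)
    (auto simp: ennreal_powr_def ennreal_mult[symmetric] powr_mult ennreal_mult_top ennreal_top_mult enn2real_mult)

lemma epowr_epowr: "(x epowr a) epowr b = x epowr (a * b)"
  by (cases x) (auto simp: ennreal_powr_def powr_powr)

lemma epowr_one: "x epowr 1 = x"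
  by (cases x) (auto simp: ennreal_powr_def)

lemma prod_epowr: "a > 0 \<Longrightarrow> (\<Prod>i\<in>I. x i) epowr a = (\<Prod>i\<in>I. x i epowr a)"
  by (induction I rule: infinite_finite_induct) (auto simp: epowr_mult, auto simp: ennreal_powr_def)

lemma sum_disjoint_indicator_le:
  fixes c :: "'b \<Rightarrow> ennreal"
  assumes "finite A" "disjoint_family_on E A" "\<And>Q. Q \<in> A \<Longrightarrow> x \<in> E Q \<Longrightarrow> c Q \<le> t"
  shows "(\<Sum>Q\<in>A. c Q * indicator (E Q) x) \<le> t"
proof (cases "\<exists>Q\<in>A. x \<in> E Q")
  case True
  then obtain Q where Q: "Q \<in> A" "x \<in> E Q" by auto
  then have "x \<notin> E R" if "R \<in> A" "R \<noteq> Q" for R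
    using assms(2) that by (auto simp: disjoint_family_on_def)
  then have "(\<Sum>R\<in>A. c R * indicator (E R) x) = (\<Sum>R\<in>A. if R = Q then c Q else 0)"
    using Q by (intro sum.cong) auto
  then show ?thesis using assms(1,3) Q by simp
next
  case False
  then have "(\<Sum>Q\<in>A. c Q * indicator (E Q) x) = (\<Sum>Q\<in>A. 0)" by (intro sum.cong) auto
  then show ?thesis by simp
qed

lemma is_weight_finite:
  fixes w :: "real ^ 'n \<Rightarrow> real"
  assumes "is_weight w" "cube_like R"
  shows "(\<integral>\<^sup>+x\<in>R. ennreal (w x) \<partial>lebesgue) < \<infinity>"
proof -
  obtain Q where Q: "Q \<in> cubes" "R \<subseteq> Q" using cube_like_closure[OF assms(2)] by metis
  then have "compact Q" by (auto simp: cubes_def)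
  then have "set_integrable lebesgue Q w" using assms(1) by (simp add: is_weight_def)
  then have "(\<integral>\<^sup>+x. ennreal (norm (indicator Q x *\<^sub>R w x)) \<partial>lebesgue) < \<infinity>"
    by (simp add: set_integrable_def integrable_iff_bounded)
  moreover have "(\<integral>\<^sup>+x\<in>R. ennreal (w x) \<partial>lebesgue) \<le> (\<integral>\<^sup>+x. ennreal (norm (indicator Q x *\<^sub>R w x)) \<partial>lebesgue)"
    using Q(2) by (intro nn_integral_mono) (auto simp: indicator_def intro: ennreal_leI)
  ultimately show ?thesis by (rule order_le_less_trans[rotated])
qed

text \<open>Allows division by the mass of a dual weight when averages are formed.\<close>

lemma is_weight_pos:
  fixes w :: "real ^ 'n \<Rightarrow> real"
  assumes "is_weight w" "cube_like R"
  shows "(\<integral>\<^sup>+x\<in>R. ennreal (w x) \<partial>lebesgue) > 0"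
proof (rule ccontr)
  have R: "R \<in> sets lebesgue" using assms(2) by (rule cube_like_sets)
  have w: "w \<in> borel_measurable lebesgue" "AE x in lebesgue. w x > 0" using assms(1) by (auto simp: is_weight_def)
  assume "\<not> ?thesis"
  then have "(\<integral>\<^sup>+x\<in>R. ennreal (w x) \<partial>lebesgue) = 0" by simp
  then have "AE x in lebesgue. ennreal (w x) * indicator R x = 0"
    using w(1) R by (subst (asm) nn_integral_0_iff_AE) auto
  then have "AE x in lebesgue. x \<notin> R"
    using w(2) by eventually_elim (auto simp: indicator_def ennreal_eq_0_iff split: if_splits)
  then have "measure lebesgue R = 0" using R by (simp add: AE_iff_measurable[OF R] measure_def)
  then show False using cube_like_measure_pos[OF assms(2)] by simp
qed

section \<open>Dual weights\<close>

lemma dual_weight_nonneg: "dual_weight P w x \<ge> 0"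
  by (simp add: dual_weight_def)

lemma dual_weight_powr:
  assumes "P > 1" "w x > 0"
  shows "dual_weight P w x powr (1 - P) = w x"
proof -
  have "(1 - conj_exponent P) * (1 - P) = 1" using assms(1) by (simp add: conj_exponent_def field_simps)
  then show ?thesis using assms(2) by (simp add: dual_weight_def powr_powr)
qed

text \<open>The substitution \<open>g = |f| / \<sigma>\<close>, with \<open>\<sigma>\<close> the
  dual weight: by \<open>\<sigma> powr (1 - P) = w\<close> it carries the norm for \<open>w\<close>
  to the norm for \<open>\<sigma>\<close>, while Lebesgue integrals of \<open>|f|\<close> become
  integrals of \<open>g\<close> with density \<open>\<sigma>\<close>.\<close>

lemma dual_weight_density:
  fixes w f :: "real ^ 'n \<Rightarrow> real"
  assumes P: "P > 1" and w: "is_weight w"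
  shows "AE x in lebesgue. ennreal (\<bar>f x\<bar> / dual_weight P w x) * ennreal (dual_weight P w x) = ennreal \<bar>f x\<bar>"
    and "(\<integral>\<^sup>+x. ennreal ((\<bar>f x\<bar> / dual_weight P w x) powr P) * ennreal (dual_weight P w x) \<partial>lebesgue)
      = (\<integral>\<^sup>+x. ennreal (\<bar>f x\<bar> powr P) * ennreal (w x) \<partial>lebesgue)"
proof -
  have pos: "AE x in lebesgue. w x > 0" using w by (simp add: is_weight_def)
  have \<sigma>: "dual_weight P w x > 0" if "w x > 0" for x using that by (simp add: dual_weight_def)
  show "AE x in lebesgue. ennreal (\<bar>f x\<bar> / dual_weight P w x) * ennreal (dual_weight P w x) = ennreal \<bar>f x\<bar>"
    using pos
  proof eventually_elim
    case (elim x)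
    then show ?case using \<sigma>[OF elim] by (simp add: ennreal_mult[symmetric])
  qed
  have "AE x in lebesgue. ennreal ((\<bar>f x\<bar> / dual_weight P w x) powr P) * ennreal (dual_weight P w x)
      = ennreal (\<bar>f x\<bar> powr P) * ennreal (w x)"
    using pos
  proof eventually_elim
    case (elim x)
    have s: "dual_weight P w x > 0" by (rule \<sigma>[OF elim])
    have "(\<bar>f x\<bar> / dual_weight P w x) powr P * dual_weight P w x
        = \<bar>f x\<bar> powr P * dual_weight P w x powr (1 - P)"
      using s by (simp add: powr_divide powr_diff)
    also have "\<dots> = \<bar>f x\<bar> powr P * w x" using dual_weight_powr[OF P, of w x] elim by simp
    finally show ?case using s elim by (simp add: ennreal_mult[symmetric])
  qed
  then show "(\<integral>\<^sup>+x. ennreal ((\<bar>f x\<bar> / dual_weight P w x) powr P) * ennreal (dual_weight P w x) \<partial>lebesgue)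
      = (\<integral>\<^sup>+x. ennreal (\<bar>f x\<bar> powr P) * ennreal (w x) \<partial>lebesgue)"
    by (rule nn_integral_cong_AE)
qed

lemma dual_weight_set_integral:
  fixes w f :: "real ^ 'n \<Rightarrow> real"
  assumes "P > 1" "is_weight w"
  shows "(\<integral>\<^sup>+x\<in>R. ennreal (\<bar>f x\<bar> / dual_weight P w x) * ennreal (dual_weight P w x) \<partial>lebesgue)
    = (\<integral>\<^sup>+x\<in>R. ennreal \<bar>f x\<bar> \<partial>lebesgue)"
  using dual_weight_density(1)[OF assms, of f] by (intro nn_integral_cong_AE) (auto elim: eventually_mono)

text \<open>In place of Hoelder, \<open>g \<le> g powr P + 1\<close> for
  \<open>g = |f| / \<sigma>\<close> bounds the integral by the norm integral of \<open>f\<close>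
  plus the \<open>\<sigma>\<close>-mass of \<open>R\<close>.\<close>

lemma weighted_Lp_locally_integrable:
  fixes w f :: "real ^ 'n \<Rightarrow> real"
  assumes P: "P > 1" and w: "is_weight w" "is_weight (dual_weight P w)"
    and f: "f \<in> weighted_Lp P w" and R: "cube_like R"
  shows "(\<integral>\<^sup>+x\<in>R. ennreal \<bar>f x\<bar> \<partial>lebesgue) < \<infinity>"
proof -
  define \<sigma> where "\<sigma> = dual_weight P w"
  define g where "g x = \<bar>f x\<bar> / \<sigma> x" for x
  have \<sigma>0: "\<sigma> x \<ge> 0" for x by (simp add: \<sigma>_def dual_weight_nonneg)
  have [measurable]: "\<sigma> \<in> borel_measurable lebesgue" "f \<in> borel_measurable lebesgue" "R \<in> sets lebesgue"
    using w(2) f cube_like_sets[OF R] by (auto simp: is_weight_def weighted_Lp_def \<sigma>_def)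
  have g[measurable]: "g \<in> borel_measurable lebesgue" unfolding g_def[abs_def] by measurable
  have g_le: "g x \<le> g x powr P + 1" for x
  proof (cases "g x \<le> 1")
    case False
    then have "g x powr 1 \<le> g x powr P" using P by (intro powr_mono) auto
    then show ?thesis using False by simp
  qed (simp add: add_increasing)
  have "(\<integral>\<^sup>+x\<in>R. ennreal \<bar>f x\<bar> \<partial>lebesgue) = (\<integral>\<^sup>+x\<in>R. ennreal (g x) * ennreal (\<sigma> x) \<partial>lebesgue)"
    unfolding g_def \<sigma>_def by (rule dual_weight_set_integral[OF P w(1), symmetric])
  also have "\<dots> \<le> (\<integral>\<^sup>+x. ennreal (g x powr P) * ennreal (\<sigma> x) + ennreal (\<sigma> x) * indicator R x \<partial>lebesgue)"
  proof (intro nn_integral_mono)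
    fix x
    have "ennreal (g x) * ennreal (\<sigma> x) \<le> ennreal (g x powr P + 1) * ennreal (\<sigma> x)"
      by (intro mult_right_mono ennreal_leI g_le) auto
    also have "\<dots> = ennreal (g x powr P) * ennreal (\<sigma> x) + ennreal (\<sigma> x)"
      by (simp add: ennreal_plus distrib_right)
    finally show "ennreal (g x) * ennreal (\<sigma> x) * indicator R x
        \<le> ennreal (g x powr P) * ennreal (\<sigma> x) + ennreal (\<sigma> x) * indicator R x"
      by (auto simp: indicator_def)
  qed
  also have "\<dots> = (\<integral>\<^sup>+x. ennreal (g x powr P) * ennreal (\<sigma> x) \<partial>lebesgue) + (\<integral>\<^sup>+x\<in>R. ennreal (\<sigma> x) \<partial>lebesgue)"
    by (rule nn_integral_add) auto
  also have "\<dots> < \<infinity>"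
    using f is_weight_finite[OF w(2) R] dual_weight_density(2)[OF P w(1), of f]
    by (simp add: weighted_Lp_def g_def \<sigma>_def)
  finally show ?thesis .
qed

text \<open>Ordinary Hoelder bounds this mass by a product of powers of the dual masses, the
  direction opposite to the hypothesis with \<open>K\<close>.\<close>

lemma nu_weight_finite:
  fixes w :: "nat \<Rightarrow> real ^ 'n \<Rightarrow> real"
  assumes m: "m \<ge> 1" and P: "\<And>i. i \<in> {1..m} \<Longrightarrow> 1 < P i" and p: "1 / p = (\<Sum>i=1..m. 1 / P i)" "p > 0"
    and \<sigma>: "\<And>i. i \<in> {1..m} \<Longrightarrow> is_weight (dual_weight (P i) (w i))" and R: "cube_like R"
  shows "weight_of (nu_weight m P p w) R < \<infinity>"
proof -
  define \<sigma> where "\<sigma> i = dual_weight (P i) (w i)" for i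
  define c where "c i = enn2real (\<integral>\<^sup>+x\<in>R. ennreal (\<sigma> i x) \<partial>lebesgue)" for i
  have pos: "P i > 0" if "i \<in> {1..m}" for i using P[OF that] by simp
  have "(\<Sum>i=1..m. p / P i) = p * (\<Sum>i=1..m. 1 / P i)" by (simp add: sum_distrib_left)
  also have "\<dots> = 1" unfolding p(1)[symmetric] using p(2) by simp
  finally have \<theta>: "(\<Sum>i=1..m. p / P i) = 1" .
  have Rm[measurable]: "R \<in> sets lebesgue" by (rule cube_like_sets[OF R])
  have "weight_of (nu_weight m P p w) R \<le> (\<integral>\<^sup>+x. (\<Prod>i=1..m. (\<sigma> i x * indicator R x) powr (p / P i)) \<partial>lebesgue)"
    unfolding weight_of_def nu_weight_def \<sigma>_def
    by (intro nn_integral_mono) (auto simp: indicator_def)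
  also have "\<dots> \<le> ennreal (\<Prod>i=1..m. c i powr (p / P i))"
  proof (rule nn_integral_prod_powr_le)
    fix i assume i: "i \<in> {1..m}"
    show "p / P i > 0" using pos[OF i] p by simp
    have [measurable]: "\<sigma> i \<in> borel_measurable lebesgue" using \<sigma>[OF i] by (simp add: is_weight_def \<sigma>_def)
    show "(\<lambda>x. \<sigma> i x * indicator R x) \<in> borel_measurable lebesgue" by measurable
    show "\<sigma> i x * indicator R x \<ge> 0" for x by (simp add: \<sigma>_def dual_weight_nonneg)
    show "c i \<ge> 0" by (simp add: c_def)
    have "(\<integral>\<^sup>+x. ennreal (\<sigma> i x * indicator R x) \<partial>lebesgue) = (\<integral>\<^sup>+x\<in>R. ennreal (\<sigma> i x) \<partial>lebesgue)"
      by (intro nn_integral_cong) (auto simp: indicator_def)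
    also have "\<dots> = ennreal (c i)"
      unfolding c_def using is_weight_finite[OF \<sigma>[OF i] R] by (simp add: \<sigma>_def)
    finally show "(\<integral>\<^sup>+x. ennreal (\<sigma> i x * indicator R x) \<partial>lebesgue) \<le> ennreal (c i)" by simp
  qed (use m \<theta> in auto)
  finally show ?thesis by (rule order_le_less_trans) simp
qed

section \<open>The two-weight inequality\<close>

text \<open>The \<open>m\<close> divisions by the volume are merged into one power. Through
  \<open>enn2real\<close> an infinite integral counts as 0, so comparisons with
  \<open>maximal\<close> assume finite integrals.\<close>

definition cube_average ::
  "nat \<Rightarrow> real \<Rightarrow> (nat \<Rightarrow> real ^ 'n \<Rightarrow> real) \<Rightarrow> (real ^ 'n) set \<Rightarrow> real" where
  "cube_average m \<alpha> f Q = measure lebesgue Q powr (\<alpha> / real CARD('n) - real m) *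
     (\<Prod>i=1..m. enn2real (\<integral>\<^sup>+y\<in>Q. ennreal \<bar>f i y\<bar> \<partial>lebesgue))"

lemma cube_average_nonneg: "cube_average m \<alpha> f Q \<ge> 0"
  unfolding cube_average_def by (intro mult_nonneg_nonneg prod_nonneg) auto

lemma cube_average_eq_term:
  fixes f :: "nat \<Rightarrow> real ^ 'n \<Rightarrow> real"
  assumes Q: "measure lebesgue Q > 0" "x \<in> Q"
    and f: "\<And>i. i \<in> {1..m} \<Longrightarrow> (\<integral>\<^sup>+y\<in>Q. ennreal \<bar>f i y\<bar> \<partial>lebesgue) < \<infinity>"
  shows "ennreal (cube_average m \<alpha> f Q) = ennreal (measure lebesgue Q powr (\<alpha> / real CARD('n))) *
    (\<Prod>i=1..m. ennreal (indicator Q x / measure lebesgue Q) * (\<integral>\<^sup>+y\<in>Q. ennreal \<bar>f i y\<bar> \<partial>lebesgue))"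
proof -
  define J where "J i = enn2real (\<integral>\<^sup>+y\<in>Q. ennreal \<bar>f i y\<bar> \<partial>lebesgue)" for i
  have "(\<Prod>i=1..m. ennreal (indicator Q x / measure lebesgue Q) * (\<integral>\<^sup>+y\<in>Q. ennreal \<bar>f i y\<bar> \<partial>lebesgue))
      = (\<Prod>i=1..m. ennreal (1 / measure lebesgue Q * J i))"
  proof (rule prod.cong[OF refl])
    fix i assume "i \<in> {1..m}"
    then have "(\<integral>\<^sup>+y\<in>Q. ennreal \<bar>f i y\<bar> \<partial>lebesgue) = ennreal (J i)" using f by (simp add: J_def)
    then show "ennreal (indicator Q x / measure lebesgue Q) * (\<integral>\<^sup>+y\<in>Q. ennreal \<bar>f i y\<bar> \<partial>lebesgue)
        = ennreal (1 / measure lebesgue Q * J i)"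
      using Q by (simp add: ennreal_mult'[symmetric])
  qed
  also have "\<dots> = ennreal (\<Prod>i=1..m. 1 / measure lebesgue Q * J i)"
    by (intro prod_ennreal) (simp add: J_def)
  also have "(\<Prod>i=1..m. 1 / measure lebesgue Q * J i) = (1 / measure lebesgue Q) ^ m * (\<Prod>i=1..m. J i)"
    by (simp add: prod_dividef power_divide)
  finally show ?thesis
    using Q(1) unfolding cube_average_def J_def[symmetric]
    by (simp add: ennreal_mult'[symmetric] powr_diff powr_realpow power_divide)
qed

lemma cube_average_le_maximal:
  fixes f :: "nat \<Rightarrow> real ^ 'n \<Rightarrow> real"
  assumes "Q \<in> cubes" "measure lebesgue Q > 0" "x \<in> Q"
    "\<And>i. i \<in> {1..m} \<Longrightarrow> (\<integral>\<^sup>+y\<in>Q. ennreal \<bar>f i y\<bar> \<partial>lebesgue) < \<infinity>"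
  shows "ennreal (cube_average m \<alpha> f Q) \<le> maximal m \<alpha> f x"
proof -
  have "ennreal (cube_average m \<alpha> f Q) = ennreal (measure lebesgue Q powr (\<alpha> / real CARD('n))) *
    (\<Prod>i=1..m. ennreal (indicator Q x / measure lebesgue Q) * (\<integral>\<^sup>+y\<in>Q. ennreal \<bar>f i y\<bar> \<partial>lebesgue))"
    using assms(2-4) by (rule cube_average_eq_term)
  also have "\<dots> \<le> maximal m \<alpha> f x"
    unfolding maximal_def by (rule SUP_upper[OF assms(1)])
  finally show ?thesis .
qed

text \<open>By \<open>\<alpha> < m n\<close> the exponent of the volume is negative, so the larger
  cube has the smaller power; the volume bound limits this loss, and the integrals only
  grow.\<close>

lemma cube_average_dilate:
  fixes f :: "nat \<Rightarrow> real ^ 'n \<Rightarrow> real"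
  assumes Q: "Q \<subseteq> R" "measure lebesgue Q > 0" "measure lebesgue R > 0"
      "measure lebesgue R \<le> 6 ^ CARD('n) * measure lebesgue Q"
    and \<alpha>: "\<alpha> < real m * real CARD('n)"
    and f: "\<And>i. i \<in> {1..m} \<Longrightarrow> (\<integral>\<^sup>+y\<in>R. ennreal \<bar>f i y\<bar> \<partial>lebesgue) < \<infinity>"
  shows "cube_average m \<alpha> f Q \<le> (1 / 6 ^ CARD('n)) powr (\<alpha> / real CARD('n) - real m) * cube_average m \<alpha> f R"
proof -
  define e where "e = \<alpha> / real CARD('n) - real m"
  have e: "e \<le> 0" using \<alpha> by (simp add: e_def field_simps)
  have "measure lebesgue Q powr e \<le> (1 / 6 ^ CARD('n) * measure lebesgue R) powr e"
    using e Q by (intro powr_mono2') (auto simp: field_simps)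
  also have "\<dots> = (1 / 6 ^ CARD('n)) powr e * measure lebesgue R powr e" by (rule powr_mult)
  finally have 1: "measure lebesgue Q powr e \<le> (1 / 6 ^ CARD('n)) powr e * measure lebesgue R powr e" .
  have 2: "(\<Prod>i=1..m. enn2real (\<integral>\<^sup>+y\<in>Q. ennreal \<bar>f i y\<bar> \<partial>lebesgue))
      \<le> (\<Prod>i=1..m. enn2real (\<integral>\<^sup>+y\<in>R. ennreal \<bar>f i y\<bar> \<partial>lebesgue))"
  proof (rule prod_mono)
    fix i assume i: "i \<in> {1..m}"
    have "(\<integral>\<^sup>+y\<in>Q. ennreal \<bar>f i y\<bar> \<partial>lebesgue) \<le> (\<integral>\<^sup>+y\<in>R. ennreal \<bar>f i y\<bar> \<partial>lebesgue)"
      using Q(1) by (intro nn_integral_mono) (auto simp: indicator_def)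
    then show "0 \<le> enn2real (\<integral>\<^sup>+y\<in>Q. ennreal \<bar>f i y\<bar> \<partial>lebesgue) \<and>
        enn2real (\<integral>\<^sup>+y\<in>Q. ennreal \<bar>f i y\<bar> \<partial>lebesgue) \<le> enn2real (\<integral>\<^sup>+y\<in>R. ennreal \<bar>f i y\<bar> \<partial>lebesgue)"
      using f[OF i] by (auto intro: enn2real_mono)
  qed
  show ?thesis
    unfolding cube_average_def e_def[symmetric] mult.assoc[symmetric]
    by (intro mult_mono 1 2 prod_nonneg) auto
qed

text \<open>Inside the root stand the dilation loss to the power \<open>q\<close>, the number
  \<open>2 ^ d\<close> of shifted grids and the embedding constant.\<close>

definition upper_const :: "nat \<Rightarrow> nat \<Rightarrow> (nat \<Rightarrow> real) \<Rightarrow> real \<Rightarrow> real \<Rightarrow> real \<Rightarrow> real" where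
  "upper_const d m P \<alpha> p q = (((1 / 6 ^ d) powr (\<alpha> / real d - real m)) powr q *
     (2 ^ d * carleson_const {1..m} P p q)) powr (1 / q)"

locale two_weight =
  fixes m :: nat and P :: "nat \<Rightarrow> real" and \<alpha> p q S :: real
    and w :: "nat \<Rightarrow> real ^ 'n \<Rightarrow> real" and v :: "real ^ 'n \<Rightarrow> real"
  assumes m: "m \<ge> 1" and P: "\<And>i. i \<in> {1..m} \<Longrightarrow> 1 < P i"
    and \<alpha>: "\<alpha> < real m * real CARD('n)"
    and p: "1 / p = (\<Sum>i=1..m. 1 / P i)" "p > 0" and q: "p \<le> q"
    and w: "\<And>i. i \<in> {1..m} \<Longrightarrow> is_weight (w i)"
    and \<sigma>: "\<And>i. i \<in> {1..m} \<Longrightarrow> is_weight (dual_weight (P i) (w i))"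
    and v: "is_weight v"
    and S: "S \<ge> 0" "sawyer_const m \<alpha> P p w q v \<le> ennreal S"
begin

lemma q_pos: "q > 0" using p q by simp

text \<open>The Carleson condition for the embedding. On \<open>E Q\<close> with
  \<open>Q \<subseteq> R\<close>, the average of the dual weights is below the maximal function of
  these weights cut off to the closed cube of \<open>R\<close>; as the \<open>E Q\<close> are
  disjoint, the sum is below the integral that the testing constant controls.\<close>

lemma testing_bound:
  assumes F: "finite F" "\<And>Q. Q \<in> F \<Longrightarrow> cube_like Q"
    and E: "\<And>Q. Q \<in> F \<Longrightarrow> E Q \<in> sets lebesgue" "\<And>Q. Q \<in> F \<Longrightarrow> E Q \<subseteq> Q" "disjoint_family_on E F"
    and R: "cube_like R"
  shows "(\<Sum>Q\<in>{Q\<in>F. Q \<subseteq> R}. cube_average m \<alpha> (\<lambda>i. dual_weight (P i) (w i)) Q powr q *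
            enn2real (\<integral>\<^sup>+x\<in>E Q. ennreal (v x) \<partial>lebesgue))
    \<le> S powr q * enn2real (weight_of (nu_weight m P p w) R) powr (q / p)"
proof -
  define b where "b = cube_average m \<alpha> (\<lambda>i. dual_weight (P i) (w i))"
  define \<nu> where "\<nu> = enn2real (weight_of (nu_weight m P p w) R)"
  have \<nu>0: "\<nu> \<ge> 0" by (simp add: \<nu>_def)
  define F' where "F' = {Q\<in>F. Q \<subseteq> R}"
  have F': "finite F'" "F' \<subseteq> F" using F(1) by (auto simp: F'_def)
  have Em: "E Q \<in> sets lebesgue" if "Q \<in> F'" for Q using E(1) that by (simp add: F'_def)
  have vm[measurable]: "v \<in> borel_measurable lebesgue" using v by (simp add: is_weight_def)
  obtain C where C: "C \<in> cubes" "R \<subseteq> C"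
    "\<And>f. (\<integral>\<^sup>+x\<in>R. f x \<partial>lebesgue) = (\<integral>\<^sup>+x\<in>C. f x \<partial>lebesgue)"
    using cube_like_closure[OF R] by metis
  let ?\<sigma>C = "\<lambda>i y. dual_weight (P i) (w i) y * indicator C y"
  have b_le: "ennreal (b Q) \<le> maximal m \<alpha> ?\<sigma>C x" if Q: "Q \<in> F'" and x: "x \<in> E Q" for Q x
  proof -
    have QF: "Q \<in> F" "Q \<subseteq> R" using Q by (auto simp: F'_def)
    have cl: "cube_like Q" using F(2) QF by simp
    obtain D where D: "D \<in> cubes" "Q \<subseteq> D" "measure lebesgue D = measure lebesgue Q"
      "\<And>f. (\<integral>\<^sup>+x\<in>Q. f x \<partial>lebesgue) = (\<integral>\<^sup>+x\<in>D. f x \<partial>lebesgue)"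
      by (rule cube_like_closure[OF cl]) (rule that)
    \<comment> \<open>Integrals over \<open>D\<close> and \<open>Q\<close> agree, and since
      \<open>Q\<close> lies in \<open>C\<close> the cut-off is invisible on
      \<open>Q\<close>.\<close>
    have eq: "(\<integral>\<^sup>+y\<in>D. ennreal \<bar>?\<sigma>C i y\<bar> \<partial>lebesgue) = (\<integral>\<^sup>+y\<in>Q. ennreal \<bar>dual_weight (P i) (w i) y\<bar> \<partial>lebesgue)" for i
    proof -
      have "Q \<subseteq> C" using QF(2) C(2) by (rule order_trans)
      then have "ennreal \<bar>?\<sigma>C i y\<bar> * indicator Q y = ennreal \<bar>dual_weight (P i) (w i) y\<bar> * indicator Q y" for y
        by (cases "y \<in> Q") (simp_all add: subset_iff)
      then show ?thesis unfolding D(4)[symmetric] by simp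
    qed
    have "b Q = cube_average m \<alpha> ?\<sigma>C D"
      unfolding b_def cube_average_def D(3) eq ..
    moreover have "ennreal (cube_average m \<alpha> ?\<sigma>C D) \<le> maximal m \<alpha> ?\<sigma>C x"
    proof (rule cube_average_le_maximal[OF D(1)])
      show "measure lebesgue D > 0" using cube_like_measure_pos[OF cl] D(3) by simp
      show "x \<in> D" using x E(2)[OF QF(1)] D(2) by auto
      show "(\<integral>\<^sup>+y\<in>D. ennreal \<bar>?\<sigma>C i y\<bar> \<partial>lebesgue) < \<infinity>" if "i \<in> {1..m}" for i
        unfolding eq using is_weight_finite[OF \<sigma>[OF that] cl] by (simp add: dual_weight_nonneg)
    qed
    ultimately show ?thesis by simp
  qed
  have vfin: "(\<integral>\<^sup>+x\<in>E Q. ennreal (v x) \<partial>lebesgue) < \<infinity>" if "Q \<in> F" for Q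
  proof -
    have "(\<integral>\<^sup>+x\<in>E Q. ennreal (v x) \<partial>lebesgue) \<le> (\<integral>\<^sup>+x\<in>Q. ennreal (v x) \<partial>lebesgue)"
      using E(2)[OF that] by (intro nn_integral_mono) (auto simp: indicator_def)
    then show ?thesis using is_weight_finite[OF v F(2)[OF that]] by (rule order_le_less_trans)
  qed
  define X where "X = (\<integral>\<^sup>+x\<in>C. (maximal m \<alpha> ?\<sigma>C x epowr q) * ennreal (v x) \<partial>lebesgue)"
  have "ennreal (\<Sum>Q\<in>F'. b Q powr q * enn2real (\<integral>\<^sup>+x\<in>E Q. ennreal (v x) \<partial>lebesgue))
      = (\<Sum>Q\<in>F'. ennreal (b Q powr q) * (\<integral>\<^sup>+x\<in>E Q. ennreal (v x) \<partial>lebesgue))"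
    using F'(2) vfin by (subst sum_ennreal[symmetric]) (auto simp: ennreal_mult' intro!: sum.cong)
  also have "\<dots> = (\<integral>\<^sup>+x. (\<Sum>Q\<in>F'. ennreal (b Q powr q) * (ennreal (v x) * indicator (E Q) x)) \<partial>lebesgue)"
    using Em by (subst nn_integral_sum) (auto simp: nn_integral_cmult intro!: sum.cong)
  also have "\<dots> \<le> X"
    unfolding X_def
  proof (intro nn_integral_mono)
    fix x
    have "(\<Sum>Q\<in>F'. ennreal (b Q powr q) * (ennreal (v x) * indicator (E Q) x))
        = (\<Sum>Q\<in>F'. ennreal (b Q powr q) * ennreal (v x) * indicator (E Q) x)" by (simp add: mult.assoc)
    also have "\<dots> \<le> (maximal m \<alpha> ?\<sigma>C x epowr q) * ennreal (v x) * indicator C x"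
    proof (rule sum_disjoint_indicator_le[OF F'(1)])
      show "disjoint_family_on E F'" using E(3) F'(2) by (rule disjoint_family_on_mono[rotated])
      fix Q assume Q: "Q \<in> F'" "x \<in> E Q"
      have "x \<in> C" using Q E(2)[of Q] C(2) by (auto simp: F'_def)
      moreover have "ennreal (b Q powr q) \<le> maximal m \<alpha> ?\<sigma>C x epowr q"
        using epowr_mono[OF b_le[OF Q], of q] q_pos by (simp add: ennreal_epowr b_def cube_average_nonneg)
      ultimately show "ennreal (b Q powr q) * ennreal (v x) \<le> (maximal m \<alpha> ?\<sigma>C x epowr q) * ennreal (v x) * indicator C x"
        by (simp add: mult_right_mono)
    qed
    finally show "(\<Sum>Q\<in>F'. ennreal (b Q powr q) * (ennreal (v x) * indicator (E Q) x))
        \<le> (maximal m \<alpha> ?\<sigma>C x epowr q) * ennreal (v x) * indicator C x" .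
  qed
  also have "X \<le> ennreal (S powr q * \<nu> powr (q / p))"
  proof -
    have \<nu>C: "weight_of (nu_weight m P p w) C = ennreal \<nu>"
      using nu_weight_finite[OF m P p \<sigma> R] unfolding \<nu>_def weight_of_def C(3) by simp
    have "X epowr (1 / q) / (weight_of (nu_weight m P p w) C epowr (1 / p)) \<le> sawyer_const m \<alpha> P p w q v"
      unfolding sawyer_const_def X_def by (rule SUP_upper2[OF C(1)]) simp
    also note S(2)
    finally have "X epowr (1 / q) / ennreal (\<nu> powr (1 / p)) \<le> ennreal S"
      by (simp add: \<nu>C ennreal_epowr \<nu>0)
    then have "X epowr (1 / q) \<le> ennreal (S * \<nu> powr (1 / p))"
    \<comment> \<open>If \<open>\<nu> = 0\<close>, the quotient is 0 or infinite by the convention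
      for division by 0, so the finite bound forces the numerator to be 0.\<close>
    proof (cases "\<nu> = 0")
      case True
      then have "X epowr (1 / q) / 0 \<le> ennreal S" using \<open>X epowr (1 / q) / ennreal (\<nu> powr (1 / p)) \<le> ennreal S\<close> by simp
      then show ?thesis by (auto simp: top_unique split: if_splits)
    next
      case False
      have pos: "\<nu> powr (1 / p) > 0" using False by simp
      have "X epowr (1 / q) = X epowr (1 / q) / ennreal (\<nu> powr (1 / p)) * ennreal (\<nu> powr (1 / p))"
        using pos by (simp add: ennreal_divide_times)
      also have "\<dots> \<le> ennreal S * ennreal (\<nu> powr (1 / p))"
        by (intro mult_right_mono \<open>X epowr (1 / q) / ennreal (\<nu> powr (1 / p)) \<le> ennreal S\<close>) simp
      finally show ?thesis using S(1) by (simp add: ennreal_mult)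
    qed
    then have "(X epowr (1 / q)) epowr q \<le> ennreal (S * \<nu> powr (1 / p)) epowr q"
      using q_pos by (intro epowr_mono) auto
    then show ?thesis
      using q_pos S(1) by (simp add: epowr_epowr epowr_one ennreal_epowr powr_mult powr_powr)
  qed
  finally show ?thesis unfolding b_def \<nu>_def F'_def using S(1) by simp
qed

text \<open>Take \<open>u\<close> equal to the \<open>q\<close>-th power of the average on each
  piece \<open>E Q\<close>. A measurable majorant that serves all of \<open>F\<close> lets the limit
  over grids be taken on majorants.\<close>

lemma grid_bound:
  assumes F: "finite F" "\<And>Q. Q \<in> F \<Longrightarrow> cube_like Q" "nested F"
    and f: "\<And>i. i \<in> {1..m} \<Longrightarrow> f i \<in> weighted_Lp (P i) (w i)"
    and J: "\<And>i. i \<in> {1..m} \<Longrightarrow> J i \<ge> 0"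
      "\<And>i. i \<in> {1..m} \<Longrightarrow> (\<integral>\<^sup>+x. ennreal (\<bar>f i x\<bar> powr P i) * ennreal (w i x) \<partial>lebesgue) = ennreal (J i)"
  shows "\<exists>u\<in>borel_measurable lebesgue.
    (\<forall>R\<in>F. \<forall>x\<in>R. ennreal (cube_average m \<alpha> f R powr q) \<le> u x) \<and>
    (\<integral>\<^sup>+x. u x * ennreal (v x) \<partial>lebesgue)
      \<le> ennreal (carleson_const {1..m} P p q * S powr q * (\<Prod>i=1..m. J i powr (q / P i)))"
proof -
  have vm[measurable]: "v \<in> borel_measurable lebesgue" using v by (simp add: is_weight_def)
  have Fm: "F \<subseteq> sets lebesgue" using F(2) cube_like_sets by blast
  define a where "a = cube_average m \<alpha> f"
  obtain E where E: "\<And>Q. Q \<in> F \<Longrightarrow> E Q \<in> sets lebesgue" "\<And>Q. Q \<in> F \<Longrightarrow> E Q \<subseteq> Q" "disjoint_family_on E F"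
    "\<And>x Q. Q \<in> F \<Longrightarrow> x \<in> Q \<Longrightarrow> \<exists>R\<in>F. x \<in> E R \<and> a Q \<le> a R"
    by (rule disjoint_linearization[OF F(1) Fm, where a=a]) (rule that)
  define u where "u x = (\<Sum>Q\<in>F. ennreal (a Q powr q) * indicator (E Q) x)" for x
  have u: "u \<in> borel_measurable lebesgue"
    unfolding u_def[abs_def] using E(1)
    by (intro borel_measurable_sum borel_measurable_times_ennreal borel_measurable_indicator) auto
  have ge: "ennreal (a Q powr q) \<le> u x" if Q: "Q \<in> F" "x \<in> Q" for Q x
  proof -
    obtain R where R: "R \<in> F" "x \<in> E R" "a Q \<le> a R" using E(4)[OF Q] by blast
    have "ennreal (a Q powr q) \<le> ennreal (a R powr q) * indicator (E R) x"
      using R q_pos by (auto simp: a_def cube_average_nonneg intro!: ennreal_leI powr_mono2)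
    also have "\<dots> \<le> u x"
      unfolding u_def using R(1) F(1)
      by (intro member_le_sum[of R F "\<lambda>Q. ennreal (a Q powr q) * indicator (E Q) x"]) auto
    finally show ?thesis .
  qed
  define s where "s i Q = enn2real (\<integral>\<^sup>+x\<in>Q. ennreal (dual_weight (P i) (w i) x) \<partial>lebesgue)" for i Q
  define I where "I i Q = enn2real (\<integral>\<^sup>+x\<in>Q. ennreal \<bar>f i x\<bar> \<partial>lebesgue)" for i Q
  define b where "b = cube_average m \<alpha> (\<lambda>i. dual_weight (P i) (w i))"
  define vE where "vE Q = enn2real (\<integral>\<^sup>+x\<in>E Q. ennreal (v x) \<partial>lebesgue)" for Q
  have vE0: "vE Q \<ge> 0" for Q by (simp add: vE_def)
  have s: "ennreal (s i Q) = (\<integral>\<^sup>+x\<in>Q. ennreal (dual_weight (P i) (w i) x) \<partial>lebesgue)" "s i Q > 0"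
    if "i \<in> {1..m}" "Q \<in> F" for i Q
    using is_weight_finite[OF \<sigma>[OF that(1)] F(2)[OF that(2)]] is_weight_pos[OF \<sigma>[OF that(1)] F(2)[OF that(2)]]
    by (simp_all add: s_def enn2real_positive_iff)
  have I: "ennreal (I i Q) = (\<integral>\<^sup>+x\<in>Q. ennreal \<bar>f i x\<bar> \<partial>lebesgue)"
    if "i \<in> {1..m}" "Q \<in> F" for i Q
    using weighted_Lp_locally_integrable[OF P[OF that(1)] w[OF that(1)] \<sigma>[OF that(1)] f[OF that(1)] F(2)[OF that(2)]]
    by (simp add: I_def)
  \<comment> \<open>The factorisation: \<open>b\<close> contains only weights, and the quotients are
    averages of \<open>|f i|\<close> over the dual weight with respect to that weight.\<close>
  have a_eq: "a Q = b Q * (\<Prod>i=1..m. I i Q / s i Q)" if Q: "Q \<in> F" for Q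
  proof -
    have "(\<Prod>i=1..m. s i Q) * (\<Prod>i=1..m. I i Q / s i Q) = (\<Prod>i=1..m. I i Q)"
      unfolding prod.distrib[symmetric] using s(2)[OF _ Q] by (intro prod.cong) (simp_all, metis less_irrefl)
    then show ?thesis
      unfolding a_def b_def cube_average_def I_def s_def by (simp add: dual_weight_nonneg mult.assoc)
  qed
  have b0: "b Q \<ge> 0" for Q by (simp add: b_def cube_average_nonneg)
  have vfin: "(\<integral>\<^sup>+x\<in>E Q. ennreal (v x) \<partial>lebesgue) < \<infinity>" if "Q \<in> F" for Q
  proof -
    have "(\<integral>\<^sup>+x\<in>E Q. ennreal (v x) \<partial>lebesgue) \<le> (\<integral>\<^sup>+x\<in>Q. ennreal (v x) \<partial>lebesgue)"
      using E(2)[OF that] by (intro nn_integral_mono) (auto simp: indicator_def)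
    then show ?thesis using is_weight_finite[OF v F(2)[OF that]] by (rule order_le_less_trans)
  qed
  have "(\<integral>\<^sup>+x. u x * ennreal (v x) \<partial>lebesgue)
      = (\<integral>\<^sup>+x. (\<Sum>Q\<in>F. ennreal (a Q powr q) * (ennreal (v x) * indicator (E Q) x)) \<partial>lebesgue)"
    unfolding u_def sum_distrib_right by (intro nn_integral_cong sum.cong refl) (simp add: ac_simps)
  also have "\<dots> = (\<Sum>Q\<in>F. ennreal (a Q powr q) * (\<integral>\<^sup>+x\<in>E Q. ennreal (v x) \<partial>lebesgue))"
    using E(1) by (subst nn_integral_sum) (auto simp: nn_integral_cmult intro!: sum.cong)
  also have "\<dots> = ennreal (\<Sum>Q\<in>F. (b Q powr q * vE Q) * (\<Prod>i=1..m. I i Q / s i Q) powr q)"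
  proof (subst sum_ennreal[symmetric])
    show "(\<Sum>Q\<in>F. ennreal (a Q powr q) * (\<integral>\<^sup>+x\<in>E Q. ennreal (v x) \<partial>lebesgue))
        = (\<Sum>Q\<in>F. ennreal (b Q powr q * vE Q * (\<Prod>i=1..m. I i Q / s i Q) powr q))"
    proof (rule sum.cong[OF refl])
      fix Q assume Q: "Q \<in> F"
      have "(\<integral>\<^sup>+x\<in>E Q. ennreal (v x) \<partial>lebesgue) = ennreal (vE Q)" using vfin[OF Q] by (simp add: vE_def)
      then show "ennreal (a Q powr q) * (\<integral>\<^sup>+x\<in>E Q. ennreal (v x) \<partial>lebesgue)
          = ennreal (b Q powr q * vE Q * (\<Prod>i=1..m. I i Q / s i Q) powr q)"
        unfolding a_eq[OF Q] powr_mult using vE0[of Q] by (simp add: ennreal_mult'[symmetric] ac_simps)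
    qed
  qed (simp add: vE_def)
  also have "\<dots> \<le> ennreal (carleson_const {1..m} P p q * S powr q * (\<Prod>i=1..m. J i powr (q / P i)))"
  proof (intro ennreal_leI carleson_embedding[where M=lebesgue and \<sigma>="\<lambda>i. dual_weight (P i) (w i)"
        and g="\<lambda>i x. \<bar>f i x\<bar> / dual_weight (P i) (w i) x"
        and \<nu>="\<lambda>R. enn2real (weight_of (nu_weight m P p w) R)"])
    fix i assume i: "i \<in> {1..m}"
    show sm: "dual_weight (P i) (w i) \<in> borel_measurable lebesgue" using \<sigma>[OF i] by (simp add: is_weight_def)
    have "f i \<in> borel_measurable lebesgue" using f[OF i] by (simp add: weighted_Lp_def)
    then show "(\<lambda>x. \<bar>f i x\<bar> / dual_weight (P i) (w i) x) \<in> borel_measurable lebesgue"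
      using sm by measurable
    show "(\<integral>\<^sup>+x. ennreal ((\<bar>f i x\<bar> / dual_weight (P i) (w i) x) powr P i) * ennreal (dual_weight (P i) (w i) x) \<partial>lebesgue)
        \<le> ennreal (J i)"
      by (simp add: dual_weight_density(2)[OF P[OF i] w[OF i]] J(2)[OF i])
    fix Q assume Q: "Q \<in> F"
    show "(\<integral>\<^sup>+x\<in>Q. ennreal (dual_weight (P i) (w i) x) \<partial>lebesgue) < \<infinity>"
      by (rule is_weight_finite[OF \<sigma>[OF i] F(2)[OF Q]])
    show "ennreal (I i Q / s i Q) * (\<integral>\<^sup>+x\<in>Q. ennreal (dual_weight (P i) (w i) x) \<partial>lebesgue)
        \<le> (\<integral>\<^sup>+x\<in>Q. ennreal (\<bar>f i x\<bar> / dual_weight (P i) (w i) x) * ennreal (dual_weight (P i) (w i) x) \<partial>lebesgue)"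
      unfolding dual_weight_set_integral[OF P[OF i] w[OF i]] s(1)[OF i Q, symmetric] I[OF i Q, symmetric]
      using s(2)[OF i Q] by (simp add: ennreal_mult''[symmetric])
  next
    fix Q assume Q: "Q \<in> F"
    have "ennreal (enn2real (weight_of (nu_weight m P p w) Q)) = weight_of (nu_weight m P p w) Q"
      using nu_weight_finite[OF m P p \<sigma> F(2)[OF Q]] by simp
    then show "ennreal (enn2real (weight_of (nu_weight m P p w) Q))
        \<le> (\<integral>\<^sup>+x\<in>Q. ennreal (\<Prod>i=1..m. dual_weight (P i) (w i) x powr (p / P i)) \<partial>lebesgue)"
      by (simp add: weight_of_def nu_weight_def)
    show "(\<Sum>Q'\<in>{Q'\<in>F. Q' \<subseteq> Q}. b Q' powr q * vE Q') \<le> S powr q * enn2real (weight_of (nu_weight m P p w) Q) powr (q / p)"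
      unfolding b_def vE_def by (rule testing_bound[OF F(1,2) E(1-3) F(2)[OF Q]])
  qed (use m P p q F Fm J in \<open>auto simp: dual_weight_nonneg vE_def I_def s_def\<close>)
  finally show ?thesis using u ge unfolding a_def by blast
qed

lemma maximal_norm_bound:
  assumes f: "\<And>i. i \<in> {1..m} \<Longrightarrow> f i \<in> weighted_Lp (P i) (w i)"
  shows "weighted_norm q v (maximal m \<alpha> f)
    \<le> ennreal (upper_const CARD('n) m P \<alpha> p q * S) * (\<Prod>i=1..m. weighted_norm (P i) (w i) (\<lambda>x. ennreal \<bar>f i x\<bar>))"
proof -
  have vm[measurable]: "v \<in> borel_measurable lebesgue" using v by (simp add: is_weight_def)
  define J where "J i = enn2real (\<integral>\<^sup>+x. ennreal (\<bar>f i x\<bar> powr P i) * ennreal (w i x) \<partial>lebesgue)" for i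
  have J0: "J i \<ge> 0" for i by (simp add: J_def)
  have J: "(\<integral>\<^sup>+x. ennreal (\<bar>f i x\<bar> powr P i) * ennreal (w i x) \<partial>lebesgue) = ennreal (J i)" if "i \<in> {1..m}" for i
    using f[OF that] by (simp add: J_def weighted_Lp_def)
  define T where "T = carleson_const {1..m} P p q * S powr q * (\<Prod>i=1..m. J i powr (q / P i))"
  have T: "T \<ge> 0" unfolding T_def carleson_const_def by (intro mult_nonneg_nonneg prod_nonneg) auto
  define c where "c = (1 / 6 ^ CARD('n)) powr (\<alpha> / real CARD('n) - real m)"
  have c: "c > 0" by (simp add: c_def)
  define good where "good N T' u \<longleftrightarrow> u \<in> borel_measurable lebesgue \<and>
      (\<forall>R\<in>grid N T'. \<forall>x\<in>R. ennreal (cube_average m \<alpha> f R powr q) \<le> u x) \<and>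
      (\<integral>\<^sup>+x. u x * ennreal (v x) \<partial>lebesgue) \<le> ennreal T" for N T' u
  have ex: "\<exists>u. good N T' u" for N T'
    unfolding good_def T_def Bex_def[symmetric]
    by (rule grid_bound[OF finite_grid _ nested_grid]) (simp_all add: f J0 J grid_cube_like)
  define u where "u N T' = (SOME u. good N T' u)" for N T'
  have "good N T' (u N T')" for N T' unfolding u_def by (rule someI_ex[OF ex])
  then have u: "\<And>N T'. u N T' \<in> borel_measurable lebesgue"
      "\<And>N T' R x. R \<in> grid N T' \<Longrightarrow> x \<in> R \<Longrightarrow> ennreal (cube_average m \<alpha> f R powr q) \<le> u N T' x"
      "\<And>N T'. (\<integral>\<^sup>+x. u N T' x * ennreal (v x) \<partial>lebesgue) \<le> ennreal T"
    by (simp_all add: good_def)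
  \<comment> \<open>Which shift covers a given cube is not known in advance; the sum over all shifts
    dominates whichever does.\<close>
  define H where "H N x = (\<Sum>T'\<in>UNIV. u N T' x)" for N x
  have H[measurable]: "H N \<in> borel_measurable lebesgue" for N
    unfolding H_def[abs_def] using u(1) by (intro borel_measurable_sum) auto
  \<comment> \<open>A cube is covered only from some \<open>N\<close> on, and the grids need not
    grow with \<open>N\<close> because the shift changes; hence liminf and Fatou rather than
    monotone convergence.\<close>
  define G where "G x = liminf (\<lambda>N. H N x)" for x
  have G[measurable]: "G \<in> borel_measurable lebesgue" unfolding G_def[abs_def] by measurable
  define k :: real where "k = 2 ^ CARD('n)"
  have card_k: "real (card (UNIV :: 'n set set)) = k" by (simp add: k_def)
  have HT: "(\<integral>\<^sup>+x. H N x * ennreal (v x) \<partial>lebesgue) \<le> ennreal (k * T)" for N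
  proof -
    have "(\<integral>\<^sup>+x. H N x * ennreal (v x) \<partial>lebesgue) = (\<Sum>T'\<in>UNIV. \<integral>\<^sup>+x. u N T' x * ennreal (v x) \<partial>lebesgue)"
      unfolding H_def sum_distrib_right using u(1) by (intro nn_integral_sum) auto
    also have "\<dots> \<le> (\<Sum>T'\<in>(UNIV :: 'n set set). ennreal T)" by (intro sum_mono u(3))
    also have "\<dots> = ennreal (k * T)" by (simp add: card_k[symmetric] ennreal_mult' ennreal_of_nat_eq_real_of_nat)
    finally show ?thesis .
  qed
  have GT: "(\<integral>\<^sup>+x. G x * ennreal (v x) \<partial>lebesgue) \<le> ennreal (k * T)"
  proof -
    have "(\<integral>\<^sup>+x. G x * ennreal (v x) \<partial>lebesgue) \<le> (\<integral>\<^sup>+x. liminf (\<lambda>N. H N x * ennreal (v x)) \<partial>lebesgue)"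
    proof (intro nn_integral_mono)
      fix x
      show "G x * ennreal (v x) \<le> liminf (\<lambda>N. H N x * ennreal (v x))"
        unfolding G_def liminf_SUP_INF SUP_mult_right_ennreal
        by (intro SUP_mono' INF_greatest mult_right_mono INF_lower) auto
    qed
    also have "\<dots> \<le> liminf (\<lambda>N. \<integral>\<^sup>+x. H N x * ennreal (v x) \<partial>lebesgue)"
      by (intro nn_integral_liminf) measurable
    also have "\<dots> \<le> ennreal (k * T)"
      using HT by (intro Liminf_le) auto
    finally show ?thesis .
  qed
  \<comment> \<open>The majorant \<open>G\<close> is measurable, so measurability of \<open>maximal\<close> itself is never needed.\<close>
  have key: "maximal m \<alpha> f x \<le> ennreal c * (G x epowr (1 / q))" for x
    unfolding maximal_def
  proof (rule SUP_least)
    fix Q :: "(real ^ 'n) set" assume Q: "Q \<in> cubes"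
    have cl: "cube_like Q" by (rule cubes_cube_like[OF Q])
    let ?t = "ennreal (measure lebesgue Q powr (\<alpha> / real CARD('n))) *
       (\<Prod>i=1..m. ennreal (indicator Q x / measure lebesgue Q) * (\<integral>\<^sup>+y\<in>Q. ennreal \<bar>f i y\<bar> \<partial>lebesgue))"
    have fin: "(\<integral>\<^sup>+y\<in>R. ennreal \<bar>f i y\<bar> \<partial>lebesgue) < \<infinity>" if "i \<in> {1..m}" "cube_like R" for i R
      by (rule weighted_Lp_locally_integrable[OF P[OF that(1)] w[OF that(1)] \<sigma>[OF that(1)] f[OF that(1)] that(2)])
    show "?t \<le> ennreal c * (G x epowr (1 / q))"
    proof (cases "x \<in> Q")
      \<comment> \<open>Off \<open>Q\<close> every factor vanishes, and \<open>m \<ge> 1\<close>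
        guarantees that there is a factor.\<close>
      case False
      then have "(\<Prod>i=1..m. ennreal (indicator Q x / measure lebesgue Q) * (\<integral>\<^sup>+y\<in>Q. ennreal \<bar>f i y\<bar> \<partial>lebesgue)) = 0"
        using m by (intro prod_zero) (auto intro!: bexI[of _ 1])
      then show ?thesis by (simp only: mult_zero_right zero_le)
    next
      case True
      have t: "?t = ennreal (cube_average m \<alpha> f Q)"
        using cube_average_eq_term[OF cube_like_measure_pos[OF cl] True fin[OF _ cl]] by simp
      obtain N0 where N0: "\<And>N. N \<ge> N0 \<Longrightarrow> \<exists>T'. \<exists>R\<in>grid N T'. Q \<subseteq> R \<and> measure lebesgue R \<le> 6 ^ CARD('n) * measure lebesgue Q"
        by (rule cube_subset_grid[OF Q]) (rule that)
      have "ennreal ((cube_average m \<alpha> f Q / c) powr q) \<le> H N x" if N: "N \<ge> N0" for N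
      proof -
        obtain T' R where R: "R \<in> grid N T'" "Q \<subseteq> R" "measure lebesgue R \<le> 6 ^ CARD('n) * measure lebesgue Q"
          using N0[OF N] by blast
        have clR: "cube_like R" by (rule grid_cube_like[OF R(1)])
        have "cube_average m \<alpha> f Q \<le> c * cube_average m \<alpha> f R"
          unfolding c_def
          by (rule cube_average_dilate[OF R(2) cube_like_measure_pos[OF cl] cube_like_measure_pos[OF clR] R(3) \<alpha> fin[OF _ clR]])
        then have "cube_average m \<alpha> f Q / c \<le> cube_average m \<alpha> f R" using c by (simp add: field_simps)
        then have "ennreal ((cube_average m \<alpha> f Q / c) powr q) \<le> ennreal (cube_average m \<alpha> f R powr q)"
          using q_pos c by (intro ennreal_leI powr_mono2) (auto simp: cube_average_nonneg)
        also have "\<dots> \<le> u N T' x" using R True by (intro u(2)) auto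
        also have "\<dots> \<le> H N x"
          unfolding H_def by (intro member_le_sum[of T' UNIV "\<lambda>T'. u N T' x"]) auto
        finally show ?thesis .
      qed
      then have "ennreal ((cube_average m \<alpha> f Q / c) powr q) \<le> (INF N\<in>{N0..}. H N x)"
        by (intro INF_greatest) auto
      also have "\<dots> \<le> G x" unfolding G_def liminf_SUP_INF by (intro SUP_upper) auto
      finally have "ennreal ((cube_average m \<alpha> f Q / c) powr q) epowr (1 / q) \<le> G x epowr (1 / q)"
        using q_pos by (intro epowr_mono) auto
      then have "ennreal (cube_average m \<alpha> f Q / c) \<le> G x epowr (1 / q)"
        using q_pos c by (simp add: ennreal_epowr powr_powr cube_average_nonneg)
      then have "ennreal c * ennreal (cube_average m \<alpha> f Q / c) \<le> ennreal c * (G x epowr (1 / q))"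
        by (rule mult_left_mono) simp
      then show ?thesis unfolding t using c by (simp add: ennreal_mult'[symmetric])
    qed
  qed
  have "(\<integral>\<^sup>+x. (maximal m \<alpha> f x epowr q) * ennreal (v x) \<partial>lebesgue)
      \<le> (\<integral>\<^sup>+x. ennreal (c powr q) * (G x * ennreal (v x)) \<partial>lebesgue)"
  proof (intro nn_integral_mono)
    fix x
    have "maximal m \<alpha> f x epowr q \<le> (ennreal c * (G x epowr (1 / q))) epowr q"
      using q_pos by (intro epowr_mono key) auto
    also have "\<dots> = ennreal (c powr q) * G x"
      using q_pos c by (simp add: epowr_mult ennreal_epowr epowr_epowr epowr_one)
    finally show "(maximal m \<alpha> f x epowr q) * ennreal (v x) \<le> ennreal (c powr q) * (G x * ennreal (v x))"
      unfolding mult.assoc[symmetric] by (rule mult_right_mono) simp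
  qed
  also have "\<dots> = ennreal (c powr q) * (\<integral>\<^sup>+x. G x * ennreal (v x) \<partial>lebesgue)"
    by (rule nn_integral_cmult) measurable
  also have "\<dots> \<le> ennreal (c powr q * (k * T))"
    using GT by (simp add: ennreal_mult' mult_left_mono)
  finally have "weighted_norm q v (maximal m \<alpha> f) \<le> ennreal (c powr q * (k * T)) epowr (1 / q)"
    unfolding weighted_norm_def using q_pos by (intro epowr_mono) auto
  also have "\<dots> = ennreal ((c powr q * (k * T)) powr (1 / q))"
    using T by (intro ennreal_epowr) (simp add: k_def)
  also have "(c powr q * (k * T)) powr (1 / q) = upper_const CARD('n) m P \<alpha> p q * S * (\<Prod>i=1..m. J i powr (1 / P i))"
    using q_pos S(1) unfolding T_def upper_const_def c_def[symmetric] k_def[symmetric]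
    by (simp add: powr_mult powr_powr prod_powr_distrib ac_simps)
  also have "ennreal \<dots> = ennreal (upper_const CARD('n) m P \<alpha> p q * S) * (\<Prod>i=1..m. ennreal (J i powr (1 / P i)))"
    by (subst prod_ennreal) (auto simp: ennreal_mult'' prod_nonneg)
  also have "(\<Prod>i=1..m. ennreal (J i powr (1 / P i))) = (\<Prod>i=1..m. weighted_norm (P i) (w i) (\<lambda>x. ennreal \<bar>f i x\<bar>))"
    by (intro prod.cong) (auto simp: weighted_norm_def ennreal_epowr J J0)
  finally show ?thesis .
qed

end

text \<open>No condition on \<open>y\<close> is needed because \<open>0 / 0 = 0\<close> and \<open>x / top = 0\<close> in \<^typ>\<open>ennreal\<close>.\<close>

lemma ennreal_divide_leI: "x \<le> c * y \<Longrightarrow> x / y \<le> (c :: ennreal)"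
  by (cases "y = 0 \<or> y = top") (auto simp: mult_divide_eq_ennreal dest: divide_right_mono_ennreal[of _ _ y])

section \<open>Necessity of the testing condition, and the equivalence\<close>

lemma sawyer_const_le_maximal_bound:
  fixes w :: "nat \<Rightarrow> real ^ 'n \<Rightarrow> real" and v :: "real ^ 'n \<Rightarrow> real"
  assumes P: "\<And>i. i \<in> {1..m} \<Longrightarrow> 1 < P i" and p: "p > 0" and q: "q > 0" and K: "K > 0"
    and w: "\<And>i. i \<in> {1..m} \<Longrightarrow> is_weight (w i)"
    and \<sigma>: "\<And>i. i \<in> {1..m} \<Longrightarrow> is_weight (dual_weight (P i) (w i))"
    and rev: "\<And>Q. Q \<in> cubes \<Longrightarrow> (\<Prod>i=1..m. weight_of (dual_weight (P i) (w i)) Q epowr (p / P i))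
                 \<le> ennreal K * weight_of (nu_weight m P p w) Q"
    and B: "maximal_bound m \<alpha> P w q v B"
  shows "sawyer_const m \<alpha> P p w q v \<le> ennreal (K powr (1 / p)) * B"
  unfolding sawyer_const_def
proof (rule SUP_least)
  fix Q :: "(real ^ 'n) set" assume Q: "Q \<in> cubes"
  define f where "f i y = dual_weight (P i) (w i) y * indicator Q y" for i y
  have cl: "cube_like Q" by (rule cubes_cube_like[OF Q])
  have Qm: "Q \<in> sets lebesgue" by (rule cube_like_sets[OF cl])
  have int: "(\<integral>\<^sup>+x. ennreal (\<bar>f i x\<bar> powr P i) * ennreal (w i x) \<partial>lebesgue) = weight_of (dual_weight (P i) (w i)) Q"
    if i: "i \<in> {1..m}" for i
    unfolding weight_of_def
  proof (rule nn_integral_cong_AE)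
    have "AE x in lebesgue. w i x > 0" using w[OF i] by (simp add: is_weight_def)
    then show "AE x in lebesgue. ennreal (\<bar>f i x\<bar> powr P i) * ennreal (w i x)
        = ennreal (dual_weight (P i) (w i) x) * indicator Q x"
    proof eventually_elim
      case (elim x)
      define s where "s = dual_weight (P i) (w i) x"
      have s: "s > 0" using elim by (simp add: s_def dual_weight_def)
      have "s powr P i * w i x = s powr P i * s powr (1 - P i)"
        unfolding s_def using dual_weight_powr[OF P[OF i], of "w i" x] elim by simp
      also have "\<dots> = s" using s by (simp add: powr_add[symmetric])
      finally show ?case
        using s elim unfolding f_def s_def[symmetric]
        by (cases "x \<in> Q") (simp_all add: ennreal_mult[symmetric])
    qed
  qed
  have fLp: "f i \<in> weighted_Lp (P i) (w i)" if i: "i \<in> {1..m}" for i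
  proof -
    have "f i \<in> borel_measurable lebesgue"
      unfolding f_def[abs_def] using \<sigma>[OF i] Qm
      by (intro borel_measurable_times borel_measurable_indicator) (auto simp: is_weight_def)
    then show ?thesis
      using int[OF i] is_weight_finite[OF \<sigma>[OF i] cl] by (simp add: weighted_Lp_def weight_of_def)
  qed
  let ?\<nu> = "weight_of (nu_weight m P p w) Q"
  have "(\<Prod>i=1..m. weighted_norm (P i) (w i) (\<lambda>x. ennreal \<bar>f i x\<bar>))
      = (\<Prod>i=1..m. weight_of (dual_weight (P i) (w i)) Q epowr (1 / P i))"
    by (intro prod.cong refl) (simp add: weighted_norm_def ennreal_epowr int)
  \<comment> \<open>Pulling out the power \<open>1 / p\<close> brings the exponents to the form
    \<open>p / P i\<close> of the reverse Hoelder hypothesis.\<close>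
  also have "\<dots> = (\<Prod>i=1..m. weight_of (dual_weight (P i) (w i)) Q epowr (p / P i)) epowr (1 / p)"
    using p by (simp add: prod_epowr epowr_epowr)
  also have "\<dots> \<le> (ennreal K * ?\<nu>) epowr (1 / p)"
    using p by (intro epowr_mono rev Q) auto
  also have "\<dots> = ennreal (K powr (1 / p)) * (?\<nu> epowr (1 / p))"
    using p K by (simp add: epowr_mult ennreal_epowr)
  finally have norms: "(\<Prod>i=1..m. weighted_norm (P i) (w i) (\<lambda>x. ennreal \<bar>f i x\<bar>))
      \<le> ennreal (K powr (1 / p)) * (?\<nu> epowr (1 / p))" .
  have "(\<integral>\<^sup>+x\<in>Q. (maximal m \<alpha> f x epowr q) * ennreal (v x) \<partial>lebesgue) epowr (1 / q)
      \<le> weighted_norm q v (maximal m \<alpha> f)"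
    unfolding weighted_norm_def using q
    by (intro epowr_mono nn_integral_mono) (auto simp: indicator_def)
  also have "\<dots> \<le> B * (\<Prod>i=1..m. weighted_norm (P i) (w i) (\<lambda>x. ennreal \<bar>f i x\<bar>))"
    using B fLp unfolding maximal_bound_def by blast
  also have "\<dots> \<le> B * (ennreal (K powr (1 / p)) * (?\<nu> epowr (1 / p)))"
    by (intro mult_left_mono norms) simp
  also have "\<dots> = ennreal (K powr (1 / p)) * B * (?\<nu> epowr (1 / p))" by (simp add: ac_simps)
  finally show "(\<integral>\<^sup>+x\<in>Q. (maximal m \<alpha> (\<lambda>i y. dual_weight (P i) (w i) y * indicator Q y) x epowr q) * ennreal (v x) \<partial>lebesgue)
      epowr (1 / q) / (?\<nu> epowr (1 / p)) \<le> ennreal (K powr (1 / p)) * B"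
    unfolding f_def by (rule ennreal_divide_leI)
qed

text \<open>\<open>C\<close> is quantified before the weights, which expresses that it depends only
  on the dimension and the numerical parameters.\<close>

theorem theorem1p4:
  fixes m :: nat and P :: "nat \<Rightarrow> real" and \<alpha> p q K :: real
  assumes "m \<ge> 1"
    and "\<And>i. i \<in> {1..m} \<Longrightarrow> 1 < P i"
    and "0 \<le> \<alpha>" and "\<alpha> < real m * real CARD('n::finite)"
    and "1 / p = (\<Sum>i=1..m. 1 / P i)"
    and "p \<le> q"
    and "K > 0"
  shows "\<exists>C>0. \<forall>(\<omega> :: nat \<Rightarrow> real ^ 'n \<Rightarrow> real) (v :: real ^ 'n \<Rightarrow> real).
    (\<forall>i\<in>{1..m}. is_weight (\<omega> i)) \<longrightarrow>
    (\<forall>i\<in>{1..m}. is_weight (dual_weight (P i) (\<omega> i))) \<longrightarrow>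
    is_weight v \<longrightarrow>
    (\<forall>Q\<in>cubes. (\<Prod>i=1..m. weight_of (dual_weight (P i) (\<omega> i)) Q epowr (p / P i))
                 \<le> ennreal K * weight_of (nu_weight m P p \<omega>) Q) \<longrightarrow>
    (maximal_bounded m \<alpha> P \<omega> q v \<longleftrightarrow> sawyer_const m \<alpha> P p \<omega> q v < \<infinity>) \<and>
    ennreal (1 / C) * sawyer_const m \<alpha> P p \<omega> q v \<le> maximal_norm m \<alpha> P \<omega> q v \<and>
    maximal_norm m \<alpha> P \<omega> q v \<le> ennreal C * sawyer_const m \<alpha> P p \<omega> q v"
proof -
  define U where "U = upper_const CARD('n) m P \<alpha> p q"
  have U: "U \<ge> 0" by (simp add: U_def upper_const_def)
  \<comment> \<open>The sum dominates the constants of both directions; the power of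
    \<open>K\<close> makes it positive, as for \<open>U\<close> only \<open>U \<ge> 0\<close> is
    established.\<close>
  define C where "C = U + K powr (1 / p)"
  have C: "C > 0" "U \<le> C" "K powr (1 / p) \<le> C" using U assms(7) by (auto simp: C_def intro!: add_nonneg_pos)
  have "(\<Sum>i=1..m. 1 / P i) > 0" using assms(1,2) by (intro sum_pos) (auto intro: order_less_trans[OF zero_less_one])
  then have p: "p > 0" using assms(5) by (metis zero_less_divide_1_iff)
  then have q: "q > 0" using assms(6) by simp
  have "(maximal_bounded m \<alpha> P \<omega> q v \<longleftrightarrow> sawyer_const m \<alpha> P p \<omega> q v < \<infinity>) \<and>
    ennreal (1 / C) * sawyer_const m \<alpha> P p \<omega> q v \<le> maximal_norm m \<alpha> P \<omega> q v \<and>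
    maximal_norm m \<alpha> P \<omega> q v \<le> ennreal C * sawyer_const m \<alpha> P p \<omega> q v"
    if w: "\<forall>i\<in>{1..m}. is_weight (\<omega> i)" "\<forall>i\<in>{1..m}. is_weight (dual_weight (P i) (\<omega> i))" "is_weight v"
      and rev: "\<forall>Q\<in>cubes. (\<Prod>i=1..m. weight_of (dual_weight (P i) (\<omega> i)) Q epowr (p / P i))
                 \<le> ennreal K * weight_of (nu_weight m P p \<omega>) Q"
    for \<omega> :: "nat \<Rightarrow> real ^ 'n \<Rightarrow> real" and v :: "real ^ 'n \<Rightarrow> real"
  proof -
    let ?S = "sawyer_const m \<alpha> P p \<omega> q v"
    have lower: "?S \<le> ennreal C * B" if "maximal_bound m \<alpha> P \<omega> q v B" for B
    proof -
      have "?S \<le> ennreal (K powr (1 / p)) * B"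
        by (rule sawyer_const_le_maximal_bound[OF assms(2) p q assms(7) _ _ _ that]) (use w rev in auto)
      also have "\<dots> \<le> ennreal C * B" using C by (intro mult_right_mono ennreal_leI) auto
      finally show ?thesis .
    qed
    have upper: "maximal_bound m \<alpha> P \<omega> q v (ennreal C * ?S)" if fin: "?S < \<infinity>"
    proof -
      define S where "S = enn2real ?S"
      have S_eq: "?S = ennreal S" using fin by (simp add: S_def)
      interpret two_weight m P \<alpha> p q S \<omega> v
        using assms p w S_eq by unfold_locales (auto simp: S_def)
      show ?thesis
        unfolding maximal_bound_def
      proof (intro allI impI)
        fix f :: "nat \<Rightarrow> real ^ 'n \<Rightarrow> real" assume f: "\<forall>i\<in>{1..m}. f i \<in> weighted_Lp (P i) (\<omega> i)"
        let ?N = "\<Prod>i=1..m. weighted_norm (P i) (\<omega> i) (\<lambda>x. ennreal \<bar>f i x\<bar>)"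
        have "weighted_norm q v (maximal m \<alpha> f) \<le> ennreal (U * S) * ?N"
          unfolding U_def using f by (intro maximal_norm_bound) auto
        also have "\<dots> \<le> ennreal C * ?S * ?N"
          unfolding S_eq ennreal_mult'[OF U] using C by (intro mult_right_mono ennreal_leI) auto
        finally show "weighted_norm q v (maximal m \<alpha> f) \<le> ennreal C * ?S * ?N" .
      qed
    qed
    have "maximal_bounded m \<alpha> P \<omega> q v \<longleftrightarrow> ?S < \<infinity>"
    proof
      assume "maximal_bounded m \<alpha> P \<omega> q v"
      then obtain B where B: "B < \<infinity>" "maximal_bound m \<alpha> P \<omega> q v B" by (auto simp: maximal_bounded_def)
      have "ennreal C * B < \<infinity>" using B(1) by (simp add: ennreal_mult_less_top)
      with lower[OF B(2)] show "?S < \<infinity>" by (rule order_le_less_trans)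
    next
      assume fin: "?S < \<infinity>"
      then have "ennreal C * ?S < \<infinity>" by (simp add: ennreal_mult_less_top)
      with upper[OF fin] show "maximal_bounded m \<alpha> P \<omega> q v" by (auto simp: maximal_bounded_def)
    qed
    moreover have "ennreal (1 / C) * ?S \<le> maximal_norm m \<alpha> P \<omega> q v"
      unfolding maximal_norm_def
    proof (rule Inf_greatest)
      fix B assume "B \<in> {B. maximal_bound m \<alpha> P \<omega> q v B}"
      then have "ennreal (1 / C) * ?S \<le> ennreal (1 / C) * (ennreal C * B)"
        by (intro mult_left_mono lower) auto
      also have "\<dots> = B" using C by (simp add: mult.assoc[symmetric] ennreal_mult[symmetric])
      finally show "ennreal (1 / C) * ?S \<le> B" .
    qed
    moreover have "maximal_norm m \<alpha> P \<omega> q v \<le> ennreal C * ?S"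
    proof (cases "?S < \<infinity>")
      case True
      then show ?thesis unfolding maximal_norm_def by (intro Inf_lower) (simp add: upper)
    next
      case False
      then have "?S = top" by (simp add: not_less top_unique)
      \<comment> \<open>Here \<open>C > 0\<close> matters: 0 times \<open>top\<close> would be
        0.\<close>
      then show ?thesis using C by (simp add: ennreal_mult_top)
    qed
    ultimately show ?thesis by blast
  qed
  note main = this
  show ?thesis
    by (rule exI[of _ C], rule conjI[OF C(1)], intro allI impI, rule main)
qed

end
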